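(* Let $k$ be an algebraically closed field of characteristic $p$ and let $d\geq p\geq 5$ and $m,n\geq d$. Then the Schur superalgebra $S(m|n,d)$ has infinite global dimension.
   Context: Let $V$ be a superspace with basis $v_1,\dots,v_{m+n}$, where $v_1,\dots,v_m$ are even and $v_{m+1},\dots,v_{m+n}$ are odd ($\bar v_i$ the parity). $\Sigma_d$ acts on the right on $V^{\otimes d}$ by $(\dots\otimes v_{i_j}\otimes v_{i_{j+1}}\otimes\dots)\cdot(j\ j{+}1)=(-1)^{\bar v_{i_j}\bar v_{i_{j+1}}}(\dots\otimes v_{i_{j+1}}\otimes v_{i_j}\otimes\dots)$. The Schur superalgebra is $S(m|n,d)=\operatorname{End}_{k\Sigma_d}(V^{\otimes d})$. *)

theory Defs
  imports "HOL-Computational_Algebra.Polynomial" "HOL-Combinatorics.Transposition"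
    "Jordan_Normal_Form.Matrix"
begin

text \<open>Basis vectors v_1,...,v_{m+n} of V are indexed 0,...,m+n-1; index i is odd
iff i >= m.  A basis tensor v_{i_0} (x) ... (x) v_{i_{d-1}} of V^{(x)d} is encoded by
the number t = sum_l i_l * (m+n)^l < (m+n)^d, so that i_l = digit (m+n) t l.
Linear endomorphisms of V^{(x)d} are (m+n)^d x (m+n)^d matrices (column j = image
of the j-th basis tensor).\<close>

definition digit :: "nat \<Rightarrow> nat \<Rightarrow> nat \<Rightarrow> nat" where
  "digit q t l = t div q ^ l mod q"

definition tensor_dim :: "nat \<Rightarrow> nat \<Rightarrow> nat \<Rightarrow> nat" where
  "tensor_dim m n d = (m + n) ^ d"

definition swap_idx :: "nat \<Rightarrow> nat \<Rightarrow> nat \<Rightarrow> nat \<Rightarrow> nat" where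
  "swap_idx q d j t = (\<Sum>l<d. digit q t (transpose j (Suc j) l) * q ^ l)"

text \<open>Sign (-1)^{parity(v_{i_j}) parity(v_{i_{j+1}})}.\<close>
definition super_sign :: "nat \<Rightarrow> nat \<Rightarrow> nat \<Rightarrow> nat \<Rightarrow> 'k::ring_1" where
  "super_sign m n j t =
     (if m \<le> digit (m + n) t j \<and> m \<le> digit (m + n) t (Suc j) then - 1 else 1)"

text \<open>Matrix of the right action of the transposition (j j+1) on V^{(x)d}:
  e_t . (j j+1) = sign(t) e_{swap t}.\<close>
definition swap_mat :: "nat \<Rightarrow> nat \<Rightarrow> nat \<Rightarrow> nat \<Rightarrow> 'k::ring_1 mat" where
  "swap_mat m n d j = mat (tensor_dim m n d) (tensor_dim m n d)
     (\<lambda>(a, b). if a = swap_idx (m + n) d j b then super_sign m n j b else 0)"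

text \<open>S(m|n,d) = End_{k Sigma_d}(V^{(x)d}); the transpositions (j j+1) generate Sigma_d.\<close>
definition schur_superalgebra :: "nat \<Rightarrow> nat \<Rightarrow> nat \<Rightarrow> 'k::field mat set" where
  "schur_superalgebra m n d =
     {M \<in> carrier_mat (tensor_dim m n d) (tensor_dim m n d).
        \<forall>j. Suc j < d \<longrightarrow> M * swap_mat m n d j = swap_mat m n d j * M}"

text \<open>A (left) module of dimension r is a unital algebra homomorphism rho : A \<rightarrow> Mat_r(k).\<close>
type_synonym 'k fdmod = "nat \<times> ('k mat \<Rightarrow> 'k mat)"

definition is_module :: "nat \<Rightarrow> 'k::field mat set \<Rightarrow> 'k fdmod \<Rightarrow> bool" where
  "is_module N A M \<longleftrightarrow>
     (\<forall>a\<in>A. snd M a \<in> carrier_mat (fst M) (fst M)) \<and>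
     snd M (1\<^sub>m N) = 1\<^sub>m (fst M) \<and>
     (\<forall>a\<in>A. \<forall>b\<in>A. snd M (a * b) = snd M a * snd M b) \<and>
     (\<forall>a\<in>A. \<forall>b\<in>A. snd M (a + b) = snd M a + snd M b) \<and>
     (\<forall>c. \<forall>a\<in>A. snd M (c \<cdot>\<^sub>m a) = c \<cdot>\<^sub>m snd M a)"

definition is_mod_hom :: "'k::field mat set \<Rightarrow> 'k fdmod \<Rightarrow> 'k fdmod \<Rightarrow> 'k mat \<Rightarrow> bool" where
  "is_mod_hom A M1 M2 F \<longleftrightarrow>
     F \<in> carrier_mat (fst M2) (fst M1) \<and> (\<forall>a\<in>A. F * snd M1 a = snd M2 a * F)"

definition mat_surj :: "nat \<Rightarrow> nat \<Rightarrow> 'k::field mat \<Rightarrow> bool" where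
  "mat_surj r1 r2 F \<longleftrightarrow> (\<forall>y\<in>carrier_vec r2. \<exists>x\<in>carrier_vec r1. F *\<^sub>v x = y)"

definition is_projective :: "nat \<Rightarrow> 'k::field mat set \<Rightarrow> 'k fdmod \<Rightarrow> bool" where
  "is_projective N A P \<longleftrightarrow> is_module N A P \<and>
     (\<forall>X Y g f. is_module N A X \<longrightarrow> is_module N A Y \<longrightarrow> is_mod_hom A X Y g \<longrightarrow>
        mat_surj (fst X) (fst Y) g \<longrightarrow> is_mod_hom A P Y f \<longrightarrow>
        (\<exists>h. is_mod_hom A P X h \<and> g * h = f))"

text \<open>M has a projective resolution 0 \<rightarrow> P_n \<rightarrow> ... \<rightarrow> P_0 \<rightarrow> M \<rightarrow> 0 of length n,
  with differentials D (Suc i) : P (Suc i) \<rightarrow> P i and augmentation D 0 : P 0 \<rightarrow> M.\<close>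
definition proj_dim_le :: "nat \<Rightarrow> 'k::field mat set \<Rightarrow> 'k fdmod \<Rightarrow> nat \<Rightarrow> bool" where
  "proj_dim_le N A M n \<longleftrightarrow>
     (\<exists>P :: nat \<Rightarrow> 'k fdmod. \<exists>D :: nat \<Rightarrow> 'k mat.
        (\<forall>i\<le>n. is_projective N A (P i)) \<and>
        is_mod_hom A (P 0) M (D 0) \<and> mat_surj (fst (P 0)) (fst M) (D 0) \<and>
        (\<forall>i<n. is_mod_hom A (P (Suc i)) (P i) (D (Suc i))) \<and>
        (\<forall>i<n. \<forall>v\<in>carrier_vec (fst (P i)).
            D i *\<^sub>v v = 0\<^sub>v (fst (if i = 0 then M else P (i - 1))) \<longleftrightarrow>
            (\<exists>w\<in>carrier_vec (fst (P (Suc i))). D (Suc i) *\<^sub>v w = v)) \<and>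
        (\<forall>v\<in>carrier_vec (fst (P n)).
            D n *\<^sub>v v = 0\<^sub>v (fst (if n = 0 then M else P (n - 1))) \<longrightarrow> v = 0\<^sub>v (fst (P n))))"

definition infinite_global_dim :: "nat \<Rightarrow> 'k::field mat set \<Rightarrow> bool" where
  "infinite_global_dim N A \<longleftrightarrow> (\<forall>n. \<exists>M. is_module N A M \<and> \<not> proj_dim_le N A M n)"

end

(* For a module M over S = S(m|n,d) let chi(M) be the alternating sum over j of
   (-1)^j dim M_j, where M_j is the weight space in which the even letter v_1 occurs p - j
   times, the odd letter v_(m+1) occurs j times and v_(m+2) occurs d - p times. This is the
   trace of a diagonal matrix z in S. It is additive on exact sequences, so that it vanishes
   on every module with a finite projective resolution if it vanishes on projective modules.

   Projective modules: it suffices that X |-> z X s has trace 0 on S for all s. Over the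
   integers the odd element g of gl(1|1) that exchanges v_1 and v_(m+1) satisfies g z = - z g
   and g g z = p z, whence p tr(z) = tr(g g z) = tr(g z g) = - p tr(z). Since S has a basis of
   signed orbit sums defined over the integers, the trace is 0 over every field of
   characteristic other than 2.

   A module with chi = 1: restricting matrices to the words whose first p letters are one
   and the same even letter is a homomorphism on S in characteristic p, and
   v_1^p v_(m+2)^(d-p) is the only one of these words in a weight space counted by chi. *)

theory Submission
  imports Defs
begin

section \<open>Additivity of traces\<close>

text \<open>The weights are chosen so that the square of g acts on them as p. Over a field of
  characteristic 0 this pairs even with odd weight spaces in every module, and the trace of z is
  always 0. In characteristic p the square is 0 there, which leaves room for a module with chi = 1,
  but p tr(z) = - p tr(z) becomes empty. The detour through the integers is made for S itself, which
  has an integral form; projective modules are reached from it as summands of free modules, where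
  the diagonal blocks of an idempotent are right multiplications X |-> X s.

  The restriction to words with constant prefix comes from the Brauer homomorphism of the p-cycle on
  the first p places, which keeps the entries at the words fixed by that cycle. Entries between
  fixed words with even and with odd prefix vanish, so the even block is multiplicative by itself.

  The letter that fills the last d - p places is odd on purpose: an even one could itself form a
  constant prefix as soon as d - p >= p, and the weight would then contain further words of the
  module.\<close>

definition mat_trace :: "'a::comm_ring_1 mat \<Rightarrow> 'a" where
  "mat_trace A = (\<Sum>i<dim_row A. A $$ (i, i))"

lemma index_mult_mat_sum:
  assumes "A \<in> carrier_mat r s" "B \<in> carrier_mat s t" "i < r" "j < t"
  shows "(A * B) $$ (i, j) = (\<Sum>l<s. A $$ (i, l) * B $$ (l, j))"
  using assms by (simp add: scalar_prod_def lessThan_atLeast0)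

lemma mat_trace_mult_comm:
  assumes A: "A \<in> carrier_mat r s" and B: "B \<in> carrier_mat s r"
  shows "mat_trace (A * B) = mat_trace (B * A)"
proof -
  have "mat_trace (A * B) = (\<Sum>i<r. \<Sum>l<s. A $$ (i, l) * B $$ (l, i))"
    unfolding mat_trace_def using index_mult_mat_sum[OF A B] A by simp
  also have "\<dots> = (\<Sum>l<s. \<Sum>i<r. B $$ (l, i) * A $$ (i, l))"
    by (subst sum.swap) (simp add: mult.commute)
  also have "\<dots> = mat_trace (B * A)"
    unfolding mat_trace_def using index_mult_mat_sum[OF B A] B by simp
  finally show ?thesis .
qed

lemma mat_trace_minus:
  assumes "A \<in> carrier_mat r r" "B \<in> carrier_mat r r"
  shows "mat_trace (A - B) = mat_trace A - mat_trace B"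
  using assms by (simp add: mat_trace_def sum_subtractf)

lemma mat_eqI_mult_unit_vec:
  fixes A B :: "'a::comm_ring_1 mat"
  assumes A: "A \<in> carrier_mat r s" and B: "B \<in> carrier_mat r s"
    and eq: "\<And>j. j < s \<Longrightarrow> A *\<^sub>v unit_vec s j = B *\<^sub>v unit_vec s j"
  shows "A = B"
proof (rule eq_matI)
  fix i j assume ij: "i < dim_row B" "j < dim_col B"
  have "(C *\<^sub>v unit_vec s j) $ i = C $$ (i, j)" if "C \<in> carrier_mat r s" for C :: "'a mat"
    using that ij B by simp
  then show "A $$ (i, j) = B $$ (i, j)"
    using eq[of j] A B ij by (metis carrier_matD(2))
qed (use A B in auto)

text \<open>The columns are lifted one at a time. The lift is merely linear and is not asked to
  commute with an algebra, which is enough for computing traces.\<close>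

lemma mat_right_factor:
  fixes D X :: "'a::comm_ring_1 mat"
  assumes D: "D \<in> carrier_mat r s" and X: "X \<in> carrier_mat r t"
    and ex: "\<And>j. j < t \<Longrightarrow> \<exists>w\<in>carrier_vec s. D *\<^sub>v w = col X j"
  shows "\<exists>h\<in>carrier_mat s t. D * h = X"
proof -
  obtain w where w: "\<And>j. j < t \<Longrightarrow> w j \<in> carrier_vec s \<and> D *\<^sub>v w j = col X j"
    using ex by metis
  let ?h = "mat_of_cols s (map w [0..<t])"
  have h: "?h \<in> carrier_mat s t" by (metis mat_of_cols_carrier(1) length_map length_upt diff_zero)
  have "D * ?h = X"
  proof (rule eq_matI)
    fix i j assume ij: "i < dim_row X" "j < dim_col X"
    then have j: "j < t" and i: "i < r" using X by auto
    have "col ?h j = w j" using w[OF j] j by (simp add: col_mat_of_cols)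
    then have "(D * ?h) $$ (i, j) = (D *\<^sub>v w j) $ i"
      using i j D h by simp
    also have "\<dots> = X $$ (i, j)" using w[OF j] ij by simp
    finally show "(D * ?h) $$ (i, j) = X $$ (i, j)" .
  qed (use D X h in auto)
  with h show ?thesis by blast
qed

lemma projective_imp_module: "is_projective N A P \<Longrightarrow> is_module N A P"
  unfolding is_projective_def by (rule conjunct1)

text \<open>Exactness lets one choose linear maps \<open>h i\<close> with
  \<open>D (i+1) h (i+1) = 1 - h i D i\<close>, and the traces of \<open>z h i D i\<close> alternate in sign because
  \<open>z\<close> commutes with the differentials.\<close>

lemma mat_trace_zero_of_proj_dim_le:
  fixes M :: "'k::field fdmod"
  assumes pd: "proj_dim_le N A M n" and M: "is_module N A M" and z: "z \<in> A"
    and P0: "\<And>P. is_projective N A P \<Longrightarrow> mat_trace (snd P z) = 0"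
  shows "mat_trace (snd M z) = 0"
proof -
  obtain P :: "nat \<Rightarrow> 'k fdmod" and D where
    proj: "\<And>i. i \<le> n \<Longrightarrow> is_projective N A (P i)" and
    D0: "is_mod_hom A (P 0) M (D 0)" and surj: "mat_surj (fst (P 0)) (fst M) (D 0)" and
    DS: "\<And>i. i < n \<Longrightarrow> is_mod_hom A (P (Suc i)) (P i) (D (Suc i))" and
    ex: "\<And>i v. i < n \<Longrightarrow> v \<in> carrier_vec (fst (P i)) \<Longrightarrow>
        D i *\<^sub>v v = 0\<^sub>v (fst (if i = 0 then M else P (i - 1))) \<longleftrightarrow>
        (\<exists>w\<in>carrier_vec (fst (P (Suc i))). D (Suc i) *\<^sub>v w = v)" and
    inj: "\<And>v. v \<in> carrier_vec (fst (P n)) \<Longrightarrow>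
        D n *\<^sub>v v = 0\<^sub>v (fst (if n = 0 then M else P (n - 1))) \<Longrightarrow> v = 0\<^sub>v (fst (P n))"
    using pd unfolding proj_dim_le_def by blast
  \<comment> \<open>\<open>Q i\<close> is the target of \<open>D i\<close>, so that the augmentation
    is treated like every other differential.\<close>
  define Q where "Q i = (if i = 0 then M else P (i - 1))" for i
  have hom: "is_mod_hom A (P i) (Q i) (D i)" if "i \<le> n" for i
    using that D0 DS unfolding Q_def by (cases i) auto
  have Dc: "D i \<in> carrier_mat (fst (Q i)) (fst (P i))" if "i \<le> n" for i
    using hom[OF that] by (simp add: is_mod_hom_def)
  have Dz: "D i * snd (P i) z = snd (Q i) z * D i" if "i \<le> n" for i
    using hom[OF that] z by (simp add: is_mod_hom_def)
  have Pz: "snd (P i) z \<in> carrier_mat (fst (P i)) (fst (P i))" "mat_trace (snd (P i) z) = 0"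
    if "i \<le> n" for i
    using projective_imp_module[OF proj[OF that]] z P0[OF proj[OF that]]
    by (auto simp: is_module_def)
  have Mz: "snd M z \<in> carrier_mat (fst M) (fst M)"
    using M z by (auto simp: is_module_def)
  \<comment> \<open>\<open>h * D i\<close> is an idempotent with the same kernel as
    \<open>D i\<close>, so the trace is that of z on the image of \<open>D i\<close>. It agrees with
    the trace on M up to the sign (-1)^i; an implication between vanishing traces avoids carrying
    this sign.\<close>
  have split: "\<exists>h\<in>carrier_mat (fst (P i)) (fst (Q i)). D i * h * D i = D i \<and>
      (mat_trace (snd (P i) z * (h * D i)) = 0 \<longrightarrow> mat_trace (snd M z) = 0)"
    if "i \<le> n" for i
    using that
  proof (induction i)
    case 0
    have "\<exists>h\<in>carrier_mat (fst (P 0)) (fst M). D 0 * h = 1\<^sub>m (fst M)"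
      using surj Dc[of 0] by (intro mat_right_factor) (auto simp: mat_surj_def Q_def)
    then obtain h where h: "h \<in> carrier_mat (fst (P 0)) (fst M)" "D 0 * h = 1\<^sub>m (fst M)"
      by blast
    have Dc0: "D 0 \<in> carrier_mat (fst M) (fst (P 0))" using Dc[of 0] by (simp add: Q_def)
    have "mat_trace (snd M z) = mat_trace (snd M z * (D 0 * h))" using h Mz by simp
    also have "\<dots> = mat_trace (D 0 * snd (P 0) z * h)"
      using Dz[of 0] Mz Dc0 h(1) by (simp add: Q_def)
    also have "\<dots> = mat_trace (D 0 * (snd (P 0) z * h))"
      using Dc0 h(1) Pz[of 0] by simp
    also have "\<dots> = mat_trace (snd (P 0) z * h * D 0)"
      by (rule mat_trace_mult_comm) (use Dc0 h(1) Pz[of 0] in auto)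
    also have "\<dots> = mat_trace (snd (P 0) z * (h * D 0))"
      using Dc0 h(1) Pz[of 0] by simp
    finally show ?case using h Dc0 by (intro bexI[of _ h]) (auto simp: Q_def)
  next
    case (Suc i)
    then have i: "i < n" "i \<le> n" by auto
    obtain h where h: "h \<in> carrier_mat (fst (P i)) (fst (Q i))" "D i * h * D i = D i"
      "mat_trace (snd (P i) z * (h * D i)) = 0 \<longrightarrow> mat_trace (snd M z) = 0"
      using Suc by auto
    have QS: "Q (Suc i) = P i" by (simp add: Q_def)
    \<comment> \<open>\<open>X\<close> projects onto the kernel of \<open>D i\<close>, which by
      exactness is the image of \<open>D (Suc i)\<close>; hence \<open>X\<close> factors through
      \<open>D (Suc i)\<close>.\<close>
    define X where "X = 1\<^sub>m (fst (P i)) - h * D i"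
    note Di = Dc[OF i(2)]
    have DS: "D (Suc i) \<in> carrier_mat (fst (P i)) (fst (P (Suc i)))"
      using Dc[of "Suc i"] i by (simp add: QS)
    have hD: "h * D i \<in> carrier_mat (fst (P i)) (fst (P i))" using h(1) Di by auto
    have X: "X \<in> carrier_mat (fst (P i)) (fst (P i))" unfolding X_def by (rule minus_carrier_mat[OF hD])
    have "D i * X = D i - D i * (h * D i)"
      unfolding X_def using mult_minus_distrib_mat[OF Di one_carrier_mat hD] Di by simp
    also have "D i * (h * D i) = D i" using h(2) assoc_mult_mat[OF Di h(1) Di] by simp
    finally have DX: "D i * X = 0\<^sub>m (fst (Q i)) (fst (P i))" using Di by simp
    have "\<exists>h'\<in>carrier_mat (fst (P (Suc i))) (fst (P i)). D (Suc i) * h' = X"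
    proof (rule mat_right_factor[OF DS X])
      fix j assume j: "j < fst (P i)"
      have "D i *\<^sub>v col X j = col (D i * X) j" using X Di j by (simp add: col_mult2)
      also have "\<dots> = 0\<^sub>v (fst (Q i))" using DX j by simp
      finally show "\<exists>w\<in>carrier_vec (fst (P (Suc i))). D (Suc i) *\<^sub>v w = col X j"
        using ex[OF i(1), of "col X j"] X j unfolding Q_def by auto
    qed
    then obtain h' where h': "h' \<in> carrier_mat (fst (P (Suc i))) (fst (P i))"
      "D (Suc i) * h' = X" by blast
    have DD: "D i * D (Suc i) = 0\<^sub>m (fst (Q i)) (fst (P (Suc i)))"
    proof (rule mat_eqI_mult_unit_vec[where s = "fst (P (Suc i))" and r = "fst (Q i)"])
      fix j
      let ?u = "unit_vec (fst (P (Suc i))) j :: 'k vec"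
      have "D (Suc i) *\<^sub>v ?u \<in> carrier_vec (fst (P i))" using DS by auto
      then have "D i *\<^sub>v (D (Suc i) *\<^sub>v ?u) = 0\<^sub>v (fst (Q i))"
        using ex[OF i(1), of "D (Suc i) *\<^sub>v ?u"] unfolding Q_def by auto
      then show "D i * D (Suc i) *\<^sub>v ?u = 0\<^sub>m (fst (Q i)) (fst (P (Suc i))) *\<^sub>v ?u"
        using assoc_mult_mat_vec[OF Di DS, of ?u] by auto
    qed (use Di DS in auto)
    have "X * D (Suc i) = D (Suc i) - h * D i * D (Suc i)"
      unfolding X_def using minus_mult_distrib_mat[OF one_carrier_mat hD DS] DS by simp
    also have "h * D i * D (Suc i) = 0\<^sub>m (fst (P i)) (fst (P (Suc i)))"
      using assoc_mult_mat[OF h(1) Di DS] DD h(1) by simp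
    also have "D (Suc i) - \<dots> = D (Suc i)" using DS by (intro eq_matI) auto
    finally have 1: "D (Suc i) * h' * D (Suc i) = D (Suc i)" using h'(2) by simp
    note PS = Pz[OF Suc.prems]
    have "mat_trace (snd (P (Suc i)) z * (h' * D (Suc i)))
        = mat_trace ((snd (P (Suc i)) z * h') * D (Suc i))"
      using PS h'(1) DS by simp
    also have "\<dots> = mat_trace (D (Suc i) * (snd (P (Suc i)) z * h'))"
      by (rule mat_trace_mult_comm) (use PS h'(1) DS in auto)
    also have "\<dots> = mat_trace (D (Suc i) * snd (P (Suc i)) z * h')"
      using PS h'(1) DS by simp
    also have "\<dots> = mat_trace (snd (P i) z * D (Suc i) * h')"
      using Dz[OF Suc.prems] QS by simp
    also have "\<dots> = mat_trace (snd (P i) z * X)"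
      using Pz[OF i(2)] h' DS by simp
    also have "\<dots> = mat_trace (snd (P i) z) - mat_trace (snd (P i) z * (h * D i))"
      unfolding X_def
      using mult_minus_distrib_mat[OF Pz(1)[OF i(2)] one_carrier_mat hD] Pz(1)[OF i(2)] hD
      by (simp add: mat_trace_minus[where r = "fst (P i)"])
    finally have "mat_trace (snd (P (Suc i)) z * (h' * D (Suc i))) = 0 \<longrightarrow> mat_trace (snd M z) = 0"
      using h(3) Pz[OF i(2)] by simp
    then show ?case using h'(1) 1 QS by auto
  qed
  obtain h where h: "h \<in> carrier_mat (fst (P n)) (fst (Q n))" "D n * h * D n = D n"
      "mat_trace (snd (P n) z * (h * D n)) = 0 \<longrightarrow> mat_trace (snd M z) = 0"
    using split[of n] by auto
  note Dn = Dc[OF order_refl]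
  \<comment> \<open>\<open>h * D n\<close> differs from the identity by vectors in the kernel of
    \<open>D n\<close>, and the last differential is injective. What remains is the full trace on
    the projective module \<open>P n\<close>.\<close>
  have "h * D n = 1\<^sub>m (fst (P n))"
  proof (rule mat_eqI_mult_unit_vec[where s = "fst (P n)" and r = "fst (P n)"])
    fix j
    let ?u = "unit_vec (fst (P n)) j :: 'k vec"
    let ?v = "h * D n *\<^sub>v ?u - ?u"
    have hD: "h * D n *\<^sub>v ?u \<in> carrier_vec (fst (P n))" using h(1) Dn by auto
    have "D n *\<^sub>v (h * D n *\<^sub>v ?u) = D n * h * D n *\<^sub>v ?u"
      using h(1) Dn by (smt (verit) assoc_mult_mat assoc_mult_mat_vec mult_carrier_mat unit_vec_carrier)
    then have "D n *\<^sub>v ?v = 0\<^sub>v (fst (Q n))"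
      using h(2) mult_minus_distrib_mat_vec[OF Dn hD unit_vec_carrier] Dn by simp
    then have "?v = 0\<^sub>v (fst (P n))" using inj[of ?v] hD unfolding Q_def by auto
    then have eq: "?v $ l = 0" if "l < fst (P n)" for l using that by simp
    have "h * D n *\<^sub>v ?u = ?u"
    proof (rule eq_vecI)
      fix l assume "l < dim_vec ?u"
      then show "(h * D n *\<^sub>v ?u) $ l = ?u $ l"
        using eq[of l] hD by (simp del: index_unit_vec(1,2) index_mult_mat_vec)
    qed (use h(1) in auto)
    then show "h * D n *\<^sub>v ?u = 1\<^sub>m (fst (P n)) *\<^sub>v ?u" by simp
  qed (use h Dn in auto)
  then have "mat_trace (snd (P n) z * (h * D n)) = 0" using Pz[OF order_refl] by simp
  with h(3) show ?thesis by blast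
qed

section \<open>Signed orbits and commutants\<close>

text \<open>The group enters through generators alone, each a signed involution. Orbits are what the
  generators reach, so that no relations between them have to be checked.\<close>

locale signed_orbits =
  fixes X :: "'x set" and J :: "'j set" and act :: "'j \<Rightarrow> 'x \<Rightarrow> 'x" and sg :: "'j \<Rightarrow> 'x \<Rightarrow> int"
  assumes finX: "finite X"
    and act_closed: "j \<in> J \<Longrightarrow> x \<in> X \<Longrightarrow> act j x \<in> X"
    and act_invol: "j \<in> J \<Longrightarrow> x \<in> X \<Longrightarrow> act j (act j x) = x"
    and sg_act: "j \<in> J \<Longrightarrow> x \<in> X \<Longrightarrow> sg j (act j x) = sg j x"
    and sg_square: "j \<in> J \<Longrightarrow> x \<in> X \<Longrightarrow> sg j x * sg j x = 1"
begin

text \<open>\<open>e\<close> is the product of the signs along a path. A point may be reached with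
  both signs, and this decides whether its orbit can carry a nonzero invariant function.\<close>

inductive reach :: "'x \<Rightarrow> int \<Rightarrow> 'x \<Rightarrow> bool" for x where
  refl: "reach x 1 x"
| step: "reach x e y \<Longrightarrow> j \<in> J \<Longrightarrow> reach x (sg j y * e) (act j y)"

definition good :: "'x \<Rightarrow> bool" where
  "good x \<longleftrightarrow> \<not> reach x (- 1) x"

text \<open>The choice depends only on the set of reachable points, hence is the same for all points
  of an orbit.\<close>

definition rep :: "'x \<Rightarrow> 'x" where
  "rep x = (SOME y. \<exists>e. reach x e y)"

definition reps :: "'x set" where
  "reps = {x \<in> X. good x \<and> rep x = x}"

text \<open>When \<open>r\<close> lies in a good orbit the first two cases exclude each other, and
  this is the invariant function supported on that orbit with value 1 at \<open>r\<close>.\<close>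

definition orbit_fun :: "'x \<Rightarrow> 'x \<Rightarrow> int" where
  "orbit_fun r y = (if reach r 1 y then 1 else if reach r (- 1) y then - 1 else 0)"

definition invariant :: "('x \<Rightarrow> 'a::comm_ring_1) \<Rightarrow> bool" where
  "invariant f \<longleftrightarrow> (\<forall>j\<in>J. \<forall>x\<in>X. f (act j x) = of_int (sg j x) * f x)"

lemma finite_reps: "finite reps"
  using finX by (simp add: reps_def)

lemma sg_cases: "j \<in> J \<Longrightarrow> x \<in> X \<Longrightarrow> sg j x = 1 \<or> sg j x = - 1"
  using sg_square[of j x] by (metis zmult_eq_1_iff)

lemma reach_closed: "reach x e y \<Longrightarrow> x \<in> X \<Longrightarrow> y \<in> X"
  by (induction rule: reach.induct) (auto simp: act_closed)

lemma reach_sign: "reach x e y \<Longrightarrow> x \<in> X \<Longrightarrow> e = 1 \<or> e = - 1"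
proof (induction rule: reach.induct)
  case (step e y j)
  with sg_cases[of j y] reach_closed[of x e y] show ?case by auto
qed simp

lemma reach_trans: "reach y e' w \<Longrightarrow> reach x e y \<Longrightarrow> reach x (e' * e) w"
proof (induction rule: reach.induct)
  case (step e' u j)
  from reach.step[OF step.IH[OF step.prems] step.hyps(2)] show ?case
    by (simp add: mult.assoc)
qed simp

lemma reach_sym: "reach x e y \<Longrightarrow> x \<in> X \<Longrightarrow> reach y e x"
proof (induction rule: reach.induct)
  case (step e y j)
  have y: "y \<in> X" using reach_closed step by blast
  have "reach (act j y) (sg j (act j y) * 1) (act j (act j y))"
    by (intro reach.intros step)
  then have "reach (act j y) (sg j y) y"
    using y step by (simp add: act_invol sg_act)
  from reach_trans[OF step.IH[OF step.prems] this] show ?case by (simp add: mult.commute)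
qed (rule reach.refl)

lemma reach_rep:
  assumes "x \<in> X" shows "\<exists>e. reach x e (rep x)"
  unfolding rep_def by (rule someI_ex) (use reach.refl in blast)

lemma rep_eq:
  assumes "x \<in> X" "reach x e y" shows "rep x = rep y"
proof -
  have "(\<exists>e'. reach x e' w) \<longleftrightarrow> (\<exists>e'. reach y e' w)" for w
    using reach_trans reach_sym[OF assms(2,1)] assms(2) by blast
  then show ?thesis by (simp add: rep_def)
qed

lemma good_unique:
  assumes "r \<in> X" "good r" "reach r e y" "reach r e' y" shows "e = e'"
proof (rule ccontr)
  assume "e \<noteq> e'"
  have "reach r (e * e') r"
    using reach_trans[OF reach_sym[OF assms(3,1)] assms(4)] by simp
  moreover have "e * e' = - 1"
    using \<open>e \<noteq> e'\<close> reach_sign[OF assms(3,1)] reach_sign[OF assms(4,1)] by auto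
  ultimately show False using assms(2) by (simp add: good_def)
qed

lemma good_reach:
  assumes "x \<in> X" "good x" "reach x e y" shows "good y"
proof -
  have "reach x (- 1) x" if "reach y (- 1) y"
  proof -
    have "reach x (e * (- 1 * e)) x"
      using reach_trans[OF reach_sym[OF assms(3,1)] reach_trans[OF that assms(3)]] .
    moreover have "e * (- 1 * e) = - 1" using reach_sign[OF assms(3,1)] by auto
    ultimately show ?thesis by simp
  qed
  then show ?thesis using assms(2) by (auto simp: good_def)
qed

lemma orbit_fun_reach:
  assumes "r \<in> X" "good r" "reach r e y" shows "orbit_fun r y = e"
proof (cases "e = 1")
  case False
  then have "e = - 1" using reach_sign[OF assms(3,1)] by simp
  moreover have "\<not> reach r 1 y" using good_unique[OF assms(1,2) _ assms(3)] False by blast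
  ultimately show ?thesis using assms(3) by (simp add: orbit_fun_def)
qed (use assms(3) in \<open>simp add: orbit_fun_def\<close>)

lemma orbit_fun_eq_0: "\<nexists>e. reach r e y \<Longrightarrow> orbit_fun r y = 0"
  by (auto simp: orbit_fun_def)

lemma invariant_reach:
  assumes "invariant f" "reach x e y" "x \<in> X" shows "f y = of_int e * f x"
  using assms(2,3)
proof (induction rule: reach.induct)
  case (step e y j)
  then show ?case using assms(1) reach_closed[of x e y] by (simp add: invariant_def mult.assoc)
qed simp

lemma invariant_orbit_fun:
  assumes r: "r \<in> reps" shows "invariant (\<lambda>y. of_int (orbit_fun r y) :: 'a::comm_ring_1)"
  unfolding invariant_def
proof (intro ballI)
  fix j y assume j: "j \<in> J" and y: "y \<in> X"
  have rX: "r \<in> X" "good r" using r by (auto simp: reps_def)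
  have "orbit_fun r (act j y) = sg j y * orbit_fun r y"
  proof (cases "\<exists>e. reach r e y")
    case True
    then obtain e where "reach r e y" by blast
    with reach.step[OF this j] show ?thesis using orbit_fun_reach rX by metis
  next
    case False
    have "\<nexists>e. reach r e (act j y)"
    proof
      assume "\<exists>e. reach r e (act j y)"
      then obtain e where "reach r e (act j y)" by blast
      from reach.step[OF this j] act_invol[OF j y] False show False by auto
    qed
    with False show ?thesis by (simp add: orbit_fun_eq_0)
  qed
  then show "(of_int (orbit_fun r (act j y)) :: 'a) = of_int (sg j y) * of_int (orbit_fun r y)"
    by simp
qed

lemma orbit_fun_reps:
  assumes "r \<in> reps" "r' \<in> reps" shows "orbit_fun r r' = (if r = r' then 1 else 0)"
proof -
  have r: "r \<in> X" "good r" "rep r = r" "rep r' = r'" using assms by (auto simp: reps_def)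
  show ?thesis
  proof (cases "\<exists>e. reach r e r'")
    case True
    then have "r = r'" using rep_eq r by metis
    then show ?thesis using orbit_fun_reach[OF r(1,2) reach.refl] by simp
  next
    case False
    then have "r \<noteq> r'" using reach.refl by blast
    then show ?thesis using orbit_fun_eq_0[OF False] by simp
  qed
qed

text \<open>The orbit functions are dual to evaluation at the representatives, so the coefficients
  are the values of \<open>f\<close> there. On an orbit that is not good a loop of sign -1 gives f y
  = - f y; this is where 2 must be cancellable.\<close>

lemma invariant_expand:
  fixes f :: "'x \<Rightarrow> 'a::comm_ring_1"
  assumes two: "\<And>a::'a. a + a = 0 \<Longrightarrow> a = 0" and f: "invariant f" and y: "y \<in> X"
  shows "f y = (\<Sum>r\<in>reps. f r * of_int (orbit_fun r y))"
proof (cases "good y")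
  case True
  obtain e where e: "reach y e (rep y)" using reach_rep[OF y] by blast
  let ?r = "rep y"
  have r: "?r \<in> X" "good ?r" "reach ?r e y" "rep ?r = ?r"
    using reach_closed[OF e y] good_reach[OF y True e] reach_sym[OF e y] rep_eq[OF y e] by auto
  then have "?r \<in> reps" by (simp add: reps_def)
  have 0: "orbit_fun r y = 0" if "r \<in> reps - {?r}" for r
  proof (rule orbit_fun_eq_0)
    show "\<nexists>e. reach r e y" using that rep_eq[of r _ y] by (auto simp: reps_def)
  qed
  have "(\<Sum>r\<in>reps. f r * of_int (orbit_fun r y)) = f ?r * of_int (orbit_fun ?r y)"
    by (subst sum.remove[OF finite_reps \<open>?r \<in> reps\<close>]) (simp add: 0)
  also have "\<dots> = f y"
    using invariant_reach[OF f r(3,1)] orbit_fun_reach[OF r(1,2,3)] by (simp add: mult.commute)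
  finally show ?thesis by simp
next
  case False
  then have "reach y (- 1) y" by (simp add: good_def)
  from invariant_reach[OF f this y] have "f y = - f y" by simp
  then have "f y + f y = 0" by (simp add: eq_neg_iff_add_eq_0)
  then have "f y = 0" by (rule two)
  moreover have "orbit_fun r y = 0" if "r \<in> reps" for r
    using that False good_reach[of r _ y] by (intro orbit_fun_eq_0) (auto simp: reps_def)
  ultimately show ?thesis by simp
qed

end

section \<open>The commutant of a signed permutation action and traces on it\<close>

locale signed_action =
  fixes N :: nat and J :: "nat set" and act :: "nat \<Rightarrow> nat \<Rightarrow> nat" and sg :: "nat \<Rightarrow> nat \<Rightarrow> int"
  assumes act_closed: "j \<in> J \<Longrightarrow> x < N \<Longrightarrow> act j x < N"
    and act_invol: "j \<in> J \<Longrightarrow> x < N \<Longrightarrow> act j (act j x) = x"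
    and sg_act: "j \<in> J \<Longrightarrow> x < N \<Longrightarrow> sg j (act j x) = sg j x"
    and sg_square: "j \<in> J \<Longrightarrow> x < N \<Longrightarrow> sg j x * sg j x = 1"
begin

text \<open>This is invariance under conjugation by the signed permutation matrices of the
  generators. Written in entries it makes sense over all commutative rings alike, and it says that
  the entries form an invariant function on pairs of points.\<close>

definition commutant :: "'a::comm_ring_1 mat set" where
  "commutant = {M \<in> carrier_mat N N. \<forall>j\<in>J. \<forall>x<N. \<forall>y<N.
     M $$ (act j x, act j y) = of_int (sg j x * sg j y) * M $$ (x, y)}"

sublocale pairs: signed_orbits "{..<N} \<times> {..<N}" J "\<lambda>j. map_prod (act j) (act j)"
  "\<lambda>j (x, y). sg j x * sg j y"
proof
  show "finite ({..<N} \<times> {..<N})" by simp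
next
  fix j x assume "j \<in> J" "x \<in> {..<N} \<times> {..<N}"
  then show "(case x of (x, y) \<Rightarrow> sg j x * sg j y) * (case x of (x, y) \<Rightarrow> sg j x * sg j y) = 1"
    using sg_square[of j "fst x"] sg_square[of j "snd x"]
    by (auto simp: mult.assoc mult.left_commute)
qed (auto simp: act_closed act_invol sg_act)

lemma commutant_iff_invariant:
  "M \<in> commutant \<longleftrightarrow> M \<in> carrier_mat N N \<and> pairs.invariant (($$) M)"
  by (auto simp: commutant_def pairs.invariant_def)

definition orbit_mat :: "nat \<times> nat \<Rightarrow> 'a::comm_ring_1 mat" where
  "orbit_mat r = mat N N (\<lambda>x. of_int (pairs.orbit_fun r x))"

lemma orbit_mat_carrier [simp]: "orbit_mat r \<in> carrier_mat N N"
  by (simp add: orbit_mat_def)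

lemma orbit_mat_dim [simp]: "dim_row (orbit_mat r) = N" "dim_col (orbit_mat r) = N"
  by (simp_all add: orbit_mat_def)

lemma commutant_carrier: "M \<in> commutant \<Longrightarrow> M \<in> carrier_mat N N"
  by (simp add: commutant_def)

lemma orbit_mat_commutant: "r \<in> pairs.reps \<Longrightarrow> orbit_mat r \<in> commutant"
  using pairs.invariant_orbit_fun[of r] act_closed
  by (auto simp: commutant_def orbit_mat_def pairs.invariant_def)

lemma orbit_mat_reps:
  assumes "r \<in> pairs.reps" "r' \<in> pairs.reps"
  shows "orbit_mat r $$ r' = (if r = r' then 1 else 0)"
  using pairs.orbit_fun_reps[OF assms] assms(2)
  by (cases r') (auto simp: orbit_mat_def pairs.reps_def)

lemma commutant_expand:
  fixes M :: "'a::comm_ring_1 mat"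
  assumes two: "\<And>a::'a. a + a = 0 \<Longrightarrow> a = 0" and M: "M \<in> commutant" and x: "x < N" "y < N"
  shows "M $$ (x, y) = (\<Sum>r\<in>pairs.reps. M $$ r * orbit_mat r $$ (x, y))"
  using pairs.invariant_expand[OF two, of "($$) M" "(x, y)"] M x
  by (simp add: commutant_iff_invariant orbit_mat_def)

lemma commutant_one: "1\<^sub>m N \<in> commutant"
proof -
  have "act j x = act j y \<longleftrightarrow> x = y" if "j \<in> J" "x < N" "y < N" for j x y
    using act_invol that by metis
  then show ?thesis
    by (auto simp: commutant_def act_closed sg_square simp flip: of_int_mult)
qed

lemma commutant_add: "A \<in> commutant \<Longrightarrow> B \<in> commutant \<Longrightarrow> A + B \<in> commutant"
  by (auto simp: commutant_def act_closed algebra_simps)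

lemma commutant_smult: "A \<in> commutant \<Longrightarrow> c \<cdot>\<^sub>m A \<in> commutant"
  by (auto simp: commutant_def act_closed algebra_simps)

lemma sum_act:
  assumes "j \<in> J" shows "(\<Sum>x<N. f (act j x)) = (\<Sum>x<N. f x)"
  by (rule sum.reindex_bij_witness[where i = "act j" and j = "act j"])
    (use assms act_closed act_invol in auto)

text \<open>The summation index is moved by \<open>act j\<close> as well; its sign then occurs twice
  and cancels.\<close>

lemma commutant_mult:
  fixes A B :: "'a::comm_ring_1 mat"
  assumes A: "A \<in> commutant" and B: "B \<in> commutant"
  shows "A * B \<in> commutant"
proof -
  note c = commutant_carrier[OF A] commutant_carrier[OF B]
  have "(A * B) $$ (act j x, act j y) = of_int (sg j x * sg j y) * (A * B) $$ (x, y)"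
    if j: "j \<in> J" and x: "x < N" and y: "y < N" for j x y
  proof -
    have "(A * B) $$ (act j x, act j y)
        = (\<Sum>l<N. A $$ (act j x, act j l) * B $$ (act j l, act j y))"
      using index_mult_mat_sum[OF c act_closed[OF j x] act_closed[OF j y]]
        sum_act[OF j, of "\<lambda>l. A $$ (act j x, l) * B $$ (l, act j y)"] by simp
    also have "\<dots> = (\<Sum>l<N. of_int (sg j x * sg j y) * (A $$ (x, l) * B $$ (l, y)))"
    proof (rule sum.cong)
      fix l assume "l \<in> {..<N}"
      then have l: "l < N" by simp
      have "(of_int (sg j l) * of_int (sg j l) :: 'a) = 1"
        using sg_square[OF j l] by (metis of_int_1 of_int_mult)
      then have "of_int (sg j x) * of_int (sg j l) * a * (of_int (sg j l) * of_int (sg j y) * b)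
          = of_int (sg j x) * of_int (sg j y) * (a * b)" for a b :: 'a
      proof -
        assume 1: "(of_int (sg j l) * of_int (sg j l) :: 'a) = 1"
        have "of_int (sg j x) * of_int (sg j l) * a * (of_int (sg j l) * of_int (sg j y) * b)
          = (of_int (sg j l) * of_int (sg j l)) * (of_int (sg j x) * of_int (sg j y) * (a * b))"
          by (simp only: ac_simps)
        then show ?thesis by (simp only: 1 mult_1_left)
      qed
      then show "A $$ (act j x, act j l) * B $$ (act j l, act j y) =
          of_int (sg j x * sg j y) * (A $$ (x, l) * B $$ (l, y))"
        using A B j x y l by (simp add: commutant_def)
    qed simp
    also have "\<dots> = of_int (sg j x * sg j y) * (A * B) $$ (x, y)"
      using index_mult_mat_sum[OF c x y] by (simp add: sum_distrib_left)
    finally show ?thesis .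
  qed
  then show ?thesis using c by (simp add: commutant_def)
qed

text \<open>The trace of the endomorphism \<open>X \<mapsto> A X B\<close> of the commutant.\<close>

definition two_sided_trace :: "'a::comm_ring_1 mat \<Rightarrow> 'a mat \<Rightarrow> 'a" where
  "two_sided_trace A B = (\<Sum>r\<in>pairs.reps. (A * orbit_mat r * B) $$ r)"

lemma reps_bound: "r \<in> pairs.reps \<Longrightarrow> fst r < N \<and> snd r < N"
  by (auto simp: pairs.reps_def)

lemma triple_product_index:
  fixes A B C :: "'a::comm_ring_1 mat"
  assumes c: "A \<in> carrier_mat N N" "B \<in> carrier_mat N N" "C \<in> carrier_mat N N"
    and i: "i < N" "j < N"
  shows "(A * B * C) $$ (i, j) = (\<Sum>l<N. \<Sum>k<N. A $$ (i, k) * B $$ (k, l) * C $$ (l, j))"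
  using index_mult_mat_sum[OF mult_carrier_mat[OF c(1,2)] c(3) i]
    index_mult_mat_sum[OF c(1,2) i(1)]
  by (simp add: sum_distrib_right)

lemma two_sided_expand:
  fixes A B M :: "'a::comm_ring_1 mat"
  assumes two: "\<And>a::'a. a + a = 0 \<Longrightarrow> a = 0" and M: "M \<in> commutant"
    and c: "A \<in> carrier_mat N N" "B \<in> carrier_mat N N" and i: "i < N" "j < N"
  shows "(A * M * B) $$ (i, j) = (\<Sum>r\<in>pairs.reps. M $$ r * (A * orbit_mat r * B) $$ (i, j))"
proof -
  have "(A * M * B) $$ (i, j) = (\<Sum>l<N. \<Sum>k<N. \<Sum>r\<in>pairs.reps.
      M $$ r * (A $$ (i, k) * orbit_mat r $$ (k, l) * B $$ (l, j)))"
    unfolding triple_product_index[OF c(1) commutant_carrier[OF M] c(2) i]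
    by (intro sum.cong refl, subst commutant_expand[OF two M])
      (auto simp: sum_distrib_left sum_distrib_right algebra_simps)
  also have "\<dots> = (\<Sum>r\<in>pairs.reps. \<Sum>l<N. \<Sum>k<N.
      M $$ r * (A $$ (i, k) * orbit_mat r $$ (k, l) * B $$ (l, j)))"
    by (subst sum.swap, subst (2) sum.swap) (rule refl)
  also have "\<dots> = (\<Sum>r\<in>pairs.reps. M $$ r * (A * orbit_mat r * B) $$ (i, j))"
    by (simp add: triple_product_index[OF c(1) orbit_mat_carrier c(2) i] sum_distrib_left)
  finally show ?thesis .
qed

text \<open>This is tr(f g) = tr(g f) for f = (X |-> A X B) and g = (X |-> A' X). Both maps preserve
  the commutant, so either composite can be expanded in coordinates at the representatives.\<close>

lemma two_sided_trace_cyclic: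
  fixes A A' B :: "'a::comm_ring_1 mat"
  assumes two: "\<And>a::'a. a + a = 0 \<Longrightarrow> a = 0"
    and A: "A \<in> commutant" and A': "A' \<in> commutant" and B: "B \<in> commutant"
  shows "two_sided_trace (A * A') B = two_sided_trace (A' * A) B"
proof -
  note c = commutant_carrier[OF A] commutant_carrier[OF A'] commutant_carrier[OF B]
  have 1: "(A * A' * orbit_mat r * B) $$ r
      = (\<Sum>s\<in>pairs.reps. (A' * orbit_mat r) $$ s * (A * orbit_mat s * B) $$ r)"
    if "r \<in> pairs.reps" for r
  proof -
    have "A * A' * orbit_mat r * B = A * (A' * orbit_mat r) * B"
      using c by (simp add: assoc_mult_mat[of _ N N _ N _ N])
    moreover have "A' * orbit_mat r \<in> commutant"
      by (intro commutant_mult A' orbit_mat_commutant that)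
    ultimately show ?thesis
      using two_sided_expand[OF two _ c(1,3), of _ "fst r" "snd r"] reps_bound[OF that] by simp
  qed
  have 2: "(A' * A * orbit_mat r * B) $$ r
      = (\<Sum>s\<in>pairs.reps. (A * orbit_mat r * B) $$ s * (A' * orbit_mat s) $$ r)"
    if "r \<in> pairs.reps" for r
  proof -
    have "A' * A * orbit_mat r * B = A' * (A * orbit_mat r * B) * 1\<^sub>m N"
      using c by (simp add: assoc_mult_mat[of _ N N _ N _ N])
    moreover have "A * orbit_mat r * B \<in> commutant"
      by (intro commutant_mult A B orbit_mat_commutant that)
    moreover have "A' * orbit_mat s * 1\<^sub>m N = A' * orbit_mat s" for s
      using c by (simp add: right_mult_one_mat[of _ N N])
    ultimately show ?thesis
      using two_sided_expand[OF two _ c(2) one_carrier_mat, of _ "fst r" "snd r"] reps_bound[OF that]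
      by simp
  qed
  have "two_sided_trace (A * A') B
      = (\<Sum>r\<in>pairs.reps. \<Sum>s\<in>pairs.reps. (A' * orbit_mat r) $$ s * (A * orbit_mat s * B) $$ r)"
    by (simp add: two_sided_trace_def 1)
  also have "\<dots> = two_sided_trace (A' * A) B"
    by (subst sum.swap) (simp add: two_sided_trace_def 2 mult.commute)
  finally show ?thesis .
qed

text \<open>The trace is computed by the same integers over every ring, so an identity
  \<open>p tr = - p tr\<close> over the integers kills it in characteristic \<open>p\<close> as well.\<close>

lemma two_sided_trace_eq_0_int:
  fixes G Z S :: "int mat"
  assumes G: "G \<in> commutant" and Z: "Z \<in> commutant" and S: "S \<in> commutant"
    and anti: "Z * G = (- 1) \<cdot>\<^sub>m (G * Z)" and sq: "G * (G * Z) = c \<cdot>\<^sub>m Z" and c: "c \<noteq> 0"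
  shows "two_sided_trace Z S = 0"
proof -
  note cs = commutant_carrier[OF G] commutant_carrier[OF Z] commutant_carrier[OF S]
  have smult: "two_sided_trace (a \<cdot>\<^sub>m Z) S = a * two_sided_trace Z S" for a
  proof -
    have "(a \<cdot>\<^sub>m Z * orbit_mat r * S) $$ r = a * (Z * orbit_mat r * S) $$ r"
      if "r \<in> pairs.reps" for r
      using triple_product_index[OF _ orbit_mat_carrier cs(3), of _ "fst r" "snd r" r]
        reps_bound[OF that] cs by (simp add: sum_distrib_left mult.assoc)
    then show ?thesis by (simp add: two_sided_trace_def sum_distrib_left)
  qed
  have "G * Z * G = G * (Z * G)" using cs by simp
  also have "\<dots> = (- 1) \<cdot>\<^sub>m (G * (G * Z))"
    unfolding anti using cs by (simp add: mult_smult_distrib[of _ N N _ N])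
  also have "\<dots> = (- c) \<cdot>\<^sub>m Z" unfolding sq using cs by (intro eq_matI) auto
  finally have "two_sided_trace (G * Z * G) S = - c * two_sided_trace Z S"
    using smult by simp
  \<comment> \<open>Cyclicity moves the outer \<open>G\<close> to the right of \<open>G * Z\<close>.
    One side is then c times the trace of \<open>Z\<close>, the other - c times.\<close>
  moreover have "two_sided_trace (G * (G * Z)) S = two_sided_trace (G * Z * G) S"
    by (rule two_sided_trace_cyclic) (use G Z S commutant_mult in auto)
  ultimately have "c * two_sided_trace Z S = - c * two_sided_trace Z S"
    using smult sq by simp
  then show ?thesis using c by simp
qed

text \<open>\<open>S\<close> may have no integral lift, but the trace is linear in \<open>S\<close>,
  and the orbit matrices in which \<open>S\<close> expands are images of integral ones.\<close>

lemma two_sided_trace_eq_0: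
  fixes G Z :: "int mat" and S :: "'a::comm_ring_1 mat"
  assumes two: "\<And>a::'a. a + a = 0 \<Longrightarrow> a = 0"
    and G: "G \<in> commutant" and Z: "Z \<in> commutant" and S: "S \<in> commutant"
    and anti: "Z * G = (- 1) \<cdot>\<^sub>m (G * Z)" and sq: "G * (G * Z) = c \<cdot>\<^sub>m Z" and c: "c \<noteq> 0"
  shows "two_sided_trace (map_mat of_int Z) S = 0"
proof -
  note Zc = commutant_carrier[OF Z] and Sc = commutant_carrier[OF S]
  have MZ: "map_mat of_int Z \<in> carrier_mat N N" using Zc by simp
  have orb: "map_mat of_int (orbit_mat u) = (orbit_mat u :: 'a mat)" for u
    by (intro eq_matI) (auto simp: orbit_mat_def)
  have hom: "two_sided_trace (map_mat of_int Z) (orbit_mat u :: 'a mat) = 0"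
    if "u \<in> pairs.reps" for u
  proof -
    have "(map_mat of_int Z * orbit_mat r * orbit_mat u :: 'a mat) $$ r
        = of_int ((Z * orbit_mat r * orbit_mat u) $$ r)" if "r \<in> pairs.reps" for r
    proof -
      have b: "fst r < N" "snd r < N" using reps_bound[OF that] by auto
      have "(map_mat of_int Z * orbit_mat r * orbit_mat u :: 'a mat) $$ (fst r, snd r)
        = (\<Sum>l<N. \<Sum>k<N. of_int (Z $$ (fst r, k) * orbit_mat r $$ (k, l) * orbit_mat u $$ (l, snd r)))"
        unfolding triple_product_index[OF MZ orbit_mat_carrier orbit_mat_carrier b]
        using Zc b by (intro sum.cong refl) (simp add: orbit_mat_def)
      also have "\<dots> = of_int ((Z * orbit_mat r * orbit_mat u) $$ (fst r, snd r))"
        unfolding triple_product_index[OF Zc orbit_mat_carrier orbit_mat_carrier b] by simp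
      finally show ?thesis by simp
    qed
    then have "two_sided_trace (map_mat of_int Z) (orbit_mat u :: 'a mat)
        = of_int (two_sided_trace Z (orbit_mat u))"
      by (simp add: two_sided_trace_def)
    also have "two_sided_trace Z (orbit_mat u) = 0"
      by (rule two_sided_trace_eq_0_int[OF G Z orbit_mat_commutant[OF that] anti sq c])
    finally show ?thesis by simp
  qed
  have "(map_mat of_int Z * orbit_mat r * S) $$ r
      = (\<Sum>u\<in>pairs.reps. S $$ u * (map_mat of_int Z * orbit_mat r * orbit_mat u) $$ r)"
    if "r \<in> pairs.reps" for r
  proof -
    have ZO: "map_mat of_int Z * orbit_mat r \<in> carrier_mat N N"
      using MZ by (rule mult_carrier_mat) simp
    \<comment> \<open>With the unit as right factor, \<open>two_sided_expand\<close> applies with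
      \<open>S\<close> in the middle place.\<close>
    then have one: "map_mat of_int Z * orbit_mat r * M * 1\<^sub>m N = map_mat of_int Z * orbit_mat r * M"
      if "M \<in> carrier_mat N N" for M :: "'a mat"
      using that by (simp add: right_mult_one_mat[of _ N N])
    show ?thesis
      using two_sided_expand[OF two S ZO one_carrier_mat, of "fst r" "snd r"]
        reps_bound[OF that] Sc by (simp add: one)
  qed
  then have "two_sided_trace (map_mat of_int Z) S
      = (\<Sum>r\<in>pairs.reps. \<Sum>u\<in>pairs.reps. S $$ u * (map_mat of_int Z * orbit_mat r * orbit_mat u) $$ r)"
    by (simp add: two_sided_trace_def)
  also have "\<dots> = (\<Sum>u\<in>pairs.reps. S $$ u * two_sided_trace (map_mat of_int Z) (orbit_mat u))"
    by (subst sum.swap) (simp add: two_sided_trace_def sum_distrib_left)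
  also have "\<dots> = 0" using hom by simp
  finally show ?thesis .
qed

end

section \<open>Traces on projective modules\<close>

lemma sum_lessThan_blocks:
  fixes f :: "nat \<Rightarrow> 'a::comm_monoid_add"
  shows "(\<Sum>l<n * r. f l) = (\<Sum>b<r. \<Sum>c<n. f (b * n + c))"
proof -
  have "(\<Sum>l<n * r. f l) = (\<Sum>b<r. sum f {b * n..<b * n + n})"
    by (simp add: sum.nat_group mult.commute)
  also have "\<dots> = (\<Sum>b<r. \<Sum>c<n. f (b * n + c))"
    by (simp add: sum.atLeastLessThan_shift_0[of f] atLeast0LessThan)
  finally show ?thesis .
qed

text \<open>The Kronecker product of a unit matrix with \<open>A\<close>; the index b * n + c stands
  for coordinate c of copy b.\<close>

definition block_copies :: "nat \<Rightarrow> nat \<Rightarrow> 'a::comm_ring_1 mat \<Rightarrow> 'a mat" where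
  "block_copies n r A = mat (n * r) (n * r)
     (\<lambda>(i, j). if i div n = j div n then A $$ (i mod n, j mod n) else 0)"

lemma block_copies_carrier [simp]: "block_copies n r A \<in> carrier_mat (n * r) (n * r)"
  by (simp add: block_copies_def)

lemma block_index_bound: "b < r \<Longrightarrow> c < n \<Longrightarrow> b * n + c < n * (r::nat)"
proof -
  assume "b < r" "c < n"
  then have "b * n + c < Suc b * n" "Suc b * n \<le> r * n" by (simp, intro mult_le_mono1, simp)
  then show ?thesis by (simp add: mult.commute)
qed

lemma block_copies_index:
  assumes "b < r" "b' < r" "c < n" "c' < n"
  shows "block_copies n r A $$ (b * n + c, b' * n + c') = (if b = b' then A $$ (c, c') else 0)"
  using assms block_index_bound by (simp add: block_copies_def)

lemma block_index_cases:
  assumes "i < n * (r::nat)"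
  obtains b c where "b < r" "c < n" "i = b * n + c"
proof
  have n: "0 < n" using assms by (cases n) auto
  show "i mod n < n" using n by simp
  show "i div n < r" using assms by (simp add: less_mult_imp_div_less mult.commute)
qed simp

lemma block_copies_mult_left:
  fixes A E :: "'a::comm_ring_1 mat"
  assumes E: "E \<in> carrier_mat (n * r) s" and b: "b < r" "c < n" "j < s"
  shows "(block_copies n r A * E) $$ (b * n + c, j) = (\<Sum>c'<n. A $$ (c, c') * E $$ (b * n + c', j))"
proof -
  have "(block_copies n r A * E) $$ (b * n + c, j)
      = (\<Sum>b'<r. \<Sum>c'<n. block_copies n r A $$ (b * n + c, b' * n + c') * E $$ (b' * n + c', j))"
    by (simp add: index_mult_mat_sum[OF block_copies_carrier E block_index_bound[OF b(1,2)] b(3)]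
        sum_lessThan_blocks)
  also have "\<dots> = (\<Sum>b'<r. if b' = b then \<Sum>c'<n. A $$ (c, c') * E $$ (b * n + c', j) else 0)"
    using b by (intro sum.cong refl) (auto simp: block_copies_index)
  also have "\<dots> = (\<Sum>c'<n. A $$ (c, c') * E $$ (b * n + c', j))"
    using b by simp
  finally show ?thesis .
qed

lemma block_copies_mult_right:
  fixes A E :: "'a::comm_ring_1 mat"
  assumes E: "E \<in> carrier_mat s (n * r)" and b: "b < r" "c < n" "i < s"
  shows "(E * block_copies n r A) $$ (i, b * n + c) = (\<Sum>c'<n. E $$ (i, b * n + c') * A $$ (c', c))"
proof -
  have "(E * block_copies n r A) $$ (i, b * n + c)
      = (\<Sum>b'<r. \<Sum>c'<n. E $$ (i, b' * n + c') * block_copies n r A $$ (b' * n + c', b * n + c))"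
    by (simp add: index_mult_mat_sum[OF E block_copies_carrier b(3) block_index_bound[OF b(1,2)]]
        sum_lessThan_blocks)
  also have "\<dots> = (\<Sum>b'<r. if b' = b then \<Sum>c'<n. E $$ (i, b * n + c') * A $$ (c', c) else 0)"
    using b by (intro sum.cong refl) (auto simp: block_copies_index)
  also have "\<dots> = (\<Sum>c'<n. E $$ (i, b * n + c') * A $$ (c', c))"
    using b by simp
  finally show ?thesis .
qed

lemma block_copies_mult:
  fixes A B :: "'a::comm_ring_1 mat"
  assumes A: "A \<in> carrier_mat n n" and B: "B \<in> carrier_mat n n"
  shows "block_copies n r (A * B) = block_copies n r A * block_copies n r B"
proof (rule eq_matI)
  fix i j assume ij: "i < dim_row (block_copies n r A * block_copies n r B)"
    "j < dim_col (block_copies n r A * block_copies n r B)"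
  then have "i < n * r" "j < n * r" by (auto simp: block_copies_def)
  then obtain b c b' c' where b: "b < r" "c < n" "i = b * n + c" "b' < r" "c' < n" "j = b' * n + c'"
    by (metis block_index_cases)
  have "(block_copies n r A * block_copies n r B) $$ (i, j)
      = (\<Sum>l<n. A $$ (c, l) * (if b = b' then B $$ (l, c') else 0))"
    using b block_index_bound
    by (simp add: block_copies_mult_left[of _ _ _ "n * r"] block_copies_index)
  also have "\<dots> = block_copies n r (A * B) $$ (i, j)"
    using b index_mult_mat_sum[OF A B b(2,5)] by (simp add: block_copies_index)
  finally show "block_copies n r (A * B) $$ (i, j) = (block_copies n r A * block_copies n r B) $$ (i, j)"
    by simp
qed (auto simp: block_copies_def)

lemma block_copies_one: "block_copies n r (1\<^sub>m n) = 1\<^sub>m (n * r)"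
proof (rule eq_matI)
  fix i j assume "i < dim_row (1\<^sub>m (n * r) :: 'a mat)" "j < dim_col (1\<^sub>m (n * r) :: 'a mat)"
  then have ij: "i < n * r" "j < n * r" by auto
  then have "0 < n" by (cases n) auto
  moreover have "i = j \<longleftrightarrow> i div n = j div n \<and> i mod n = j mod n"
    by (metis div_mult_mod_eq)
  ultimately show "block_copies n r (1\<^sub>m n) $$ (i, j) = (1\<^sub>m (n * r) :: 'a mat) $$ (i, j)"
    using ij by (auto simp: block_copies_def)
qed (auto simp: block_copies_def)

lemma is_module_block_copies:
  assumes "is_module N A (n, \<rho>)"
  shows "is_module N A (n * r, \<lambda>a. block_copies n r (\<rho> a))"
proof -
  have c: "\<rho> a \<in> carrier_mat n n" if "a \<in> A" for a
    using assms that by (simp add: is_module_def)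
  have dm: "i mod n < n" if "i < n * r" for i using that by (cases n) auto
  have "block_copies n r (B + C) = block_copies n r B + block_copies n r C"
    if "B \<in> carrier_mat n n" "C \<in> carrier_mat n n" for B C :: "'a mat"
    using that dm by (intro eq_matI) (auto simp: block_copies_def)
  moreover have "block_copies n r (x \<cdot>\<^sub>m B) = x \<cdot>\<^sub>m block_copies n r B"
    if "B \<in> carrier_mat n n" for B :: "'a mat" and x
    using that dm by (intro eq_matI) (auto simp: block_copies_def)
  ultimately show ?thesis
    using assms c by (simp add: is_module_def block_copies_one block_copies_mult)
qed

text \<open>The first factor is block diagonal with equal blocks, so only the diagonal blocks of
  \<open>E\<close> enter.\<close>

lemma mat_trace_block_copies_mult:
  fixes A E :: "'a::comm_ring_1 mat"
  assumes A: "A \<in> carrier_mat n n" and E: "E \<in> carrier_mat (n * r) (n * r)"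
  shows "mat_trace (block_copies n r A * E)
      = (\<Sum>b<r. mat_trace (A * mat n n (\<lambda>(c, c'). E $$ (b * n + c, b * n + c'))))"
proof -
  have "mat_trace (block_copies n r A * E)
      = (\<Sum>b<r. \<Sum>c<n. (block_copies n r A * E) $$ (b * n + c, b * n + c))"
    using sum_lessThan_blocks[of _ n r] by (simp add: mat_trace_def block_copies_def)
  also have "\<dots> = (\<Sum>b<r. mat_trace (A * mat n n (\<lambda>(c, c'). E $$ (b * n + c, b * n + c'))))"
  proof (intro sum.cong refl)
    fix b assume b: "b \<in> {..<r}"
    let ?B = "mat n n (\<lambda>(c, c'). E $$ (b * n + c, b * n + c'))"
    have "(block_copies n r A * E) $$ (b * n + c, b * n + c) = (A * ?B) $$ (c, c)" if "c < n" for c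
      using b that block_copies_mult_left[OF E, of b c "b * n + c" A] block_index_bound[of b r c n]
        index_mult_mat_sum[OF A, of ?B n c c] by simp
    then show "(\<Sum>c<n. (block_copies n r A * E) $$ (b * n + c, b * n + c)) = mat_trace (A * ?B)"
      using A by (simp add: mat_trace_def del: index_mult_mat(1))
  qed
  finally show ?thesis .
qed

lemma projective_split:
  assumes P: "is_projective N A P" and X: "is_module N A X"
    and g: "is_mod_hom A X P g" "mat_surj (fst X) (fst P) g"
  obtains h where "is_mod_hom A P X h" "g * h = 1\<^sub>m (fst P)"
proof -
  have M: "is_module N A P" by (rule projective_imp_module[OF P])
  then have "is_mod_hom A P P (1\<^sub>m (fst P))"
    by (auto simp: is_module_def is_mod_hom_def)
  then show ?thesis using P X M g that unfolding is_projective_def by blast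
qed

section \<open>The left regular module and projective modules as summands of its copies\<close>

context signed_action
begin

text \<open>The converse of reading off coordinates: it turns prescribed values at the
  representatives into an element of the commutant.\<close>

definition orbit_comb :: "(nat \<times> nat \<Rightarrow> 'a) \<Rightarrow> 'a::comm_ring_1 mat" where
  "orbit_comb t = mat N N (\<lambda>x. \<Sum>u\<in>pairs.reps. t u * orbit_mat u $$ x)"

lemma orbit_comb_commutant:
  fixes t :: "nat \<times> nat \<Rightarrow> 'a::comm_ring_1"
  shows "orbit_comb t \<in> commutant"
proof -
  have o: "(orbit_mat u :: 'a mat) $$ (act j x, act j y)
      = of_int (sg j x * sg j y) * orbit_mat u $$ (x, y)"
    if "u \<in> pairs.reps" "j \<in> J" "x < N" "y < N" for u j x y
    using orbit_mat_commutant[OF that(1), where 'a = 'a] that by (simp add: commutant_def)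
  have "orbit_comb t $$ (act j x, act j y) = of_int (sg j x * sg j y) * orbit_comb t $$ (x, y)"
    if "j \<in> J" "x < N" "y < N" for j x y
  proof -
    have "orbit_comb t $$ (act j x, act j y)
        = (\<Sum>u\<in>pairs.reps. t u * (of_int (sg j x * sg j y) * orbit_mat u $$ (x, y)))"
      using that by (simp add: orbit_comb_def act_closed o)
    then show ?thesis
      using that by (simp add: orbit_comb_def sum_distrib_left mult.left_commute)
  qed
  then show ?thesis by (simp add: commutant_def orbit_comb_def)
qed

lemma orbit_comb_rep:
  assumes "r \<in> pairs.reps" shows "orbit_comb t $$ r = t r"
proof -
  have "orbit_comb t $$ r = (\<Sum>u\<in>pairs.reps. t u * orbit_mat u $$ r)"
    using reps_bound[OF assms] by (cases r) (simp add: orbit_comb_def)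
  also have "\<dots> = (\<Sum>u\<in>pairs.reps. if u = r then t u else 0)"
    using assms by (intro sum.cong refl) (simp add: orbit_mat_reps)
  also have "\<dots> = t r" using assms pairs.finite_reps by simp
  finally show ?thesis .
qed

lemma left_expand:
  fixes A M :: "'a::comm_ring_1 mat"
  assumes two: "\<And>a::'a. a + a = 0 \<Longrightarrow> a = 0" and M: "M \<in> commutant"
    and A: "A \<in> carrier_mat N N" and r: "r \<in> pairs.reps"
  shows "(A * M) $$ r = (\<Sum>u\<in>pairs.reps. M $$ u * (A * orbit_mat u) $$ r)"
proof -
  have one: "A * B * 1\<^sub>m N = A * B" if "B \<in> carrier_mat N N" for B :: "'a mat"
    using that A by (simp add: right_mult_one_mat[of _ N N])
  show ?thesis
    using two_sided_expand[OF two M A one_carrier_mat, of "fst r" "snd r"] reps_bound[OF r]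
      commutant_carrier[OF M] by (simp add: one)
qed

text \<open>Modules are required to respect sums of two elements; the induction over sets of
  representatives extends this to the whole expansion in the basis.\<close>

lemma module_orbit_expand:
  fixes M :: "'k::field mat"
  assumes P: "is_module N commutant P" and two: "\<And>a::'k. a + a = 0 \<Longrightarrow> a = 0"
    and M: "M \<in> commutant" and i: "i < fst P" "b < fst P"
  shows "snd P M $$ (i, b) = (\<Sum>u\<in>pairs.reps. M $$ u * snd P (orbit_mat u) $$ (i, b))"
proof -
  let ?s = "\<lambda>U. mat N N (\<lambda>x. \<Sum>u\<in>U. M $$ u * orbit_mat u $$ x) :: 'k mat"
  have "?s U \<in> commutant \<and>
      snd P (?s U) $$ (i, b) = (\<Sum>u\<in>U. M $$ u * snd P (orbit_mat u) $$ (i, b))"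
    if "finite U" "U \<subseteq> pairs.reps" for U
    using that
  proof (induction U)
    case empty
    \<comment> \<open>The empty sum is written as 0 times the unit, since the module axioms speak of
      units and scalar multiples but not of the zero matrix.\<close>
    have 0: "?s {} = 0 \<cdot>\<^sub>m 1\<^sub>m N" by (intro eq_matI) auto
    have "snd P (0 \<cdot>\<^sub>m 1\<^sub>m N) = 0 \<cdot>\<^sub>m 1\<^sub>m (fst P)"
      using P commutant_one[where 'a = 'k] by (simp add: is_module_def)
    with i show ?case unfolding 0 using commutant_smult[OF commutant_one] by simp
  next
    case (insert u U)
    have 1: "?s (insert u U) = M $$ u \<cdot>\<^sub>m orbit_mat u + ?s U"
      using insert(1,2) by (intro eq_matI) (auto simp: orbit_mat_def)
    have u: "(orbit_mat u :: 'k mat) \<in> commutant" by (rule orbit_mat_commutant) (use insert.prems in simp)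
    have U: "?s U \<in> commutant" using insert by simp
    have "snd P (M $$ u \<cdot>\<^sub>m orbit_mat u + ?s U) = M $$ u \<cdot>\<^sub>m snd P (orbit_mat u) + snd P (?s U)"
      using P u U commutant_smult[OF u, of "M $$ u"] by (simp add: is_module_def)
    moreover have "snd P (orbit_mat u) \<in> carrier_mat (fst P) (fst P)"
        "snd P (?s U) \<in> carrier_mat (fst P) (fst P)"
      using P u U by (auto simp: is_module_def)
    ultimately show ?case
      unfolding 1 using i insert commutant_add[OF commutant_smult[OF u] U] by simp
  qed
  moreover have "?s pairs.reps = M"
    using commutant_expand[OF two M] commutant_carrier[OF M] by (intro eq_matI) auto
  ultimately show ?thesis using pairs.finite_reps by force
qed

text \<open>Left multiplication by \<open>a\<close> in the basis of orbit matrices enumerated by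
  \<open>e\<close>; the coordinates of a product are its entries at the representatives.\<close>

definition regular_rep :: "(nat \<Rightarrow> nat \<times> nat) \<Rightarrow> 'a::comm_ring_1 mat \<Rightarrow> 'a mat" where
  "regular_rep e a = mat (card pairs.reps) (card pairs.reps) (\<lambda>(c, c'). (a * orbit_mat (e c')) $$ e c)"

lemma sum_reps:
  assumes "bij_betw e {..<card pairs.reps} pairs.reps"
  shows "(\<Sum>u\<in>pairs.reps. f u) = (\<Sum>c<card pairs.reps. f (e c))"
  by (simp add: sum.reindex_bij_betw[OF assms])

lemma regular_rep_module:
  assumes two: "\<And>a::'k::field. a + a = 0 \<Longrightarrow> a = 0"
    and e: "bij_betw e {..<card pairs.reps} pairs.reps"
  shows "is_module N (commutant :: 'k mat set) (card pairs.reps, regular_rep e)"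
proof -
  let ?n = "card pairs.reps"
  have er: "e c \<in> pairs.reps" if "c < ?n" for c using e that by (auto simp: bij_betw_def)
  have eb: "fst (e c) < N" "snd (e c) < N" if "c < ?n" for c using reps_bound[OF er[OF that]] by auto
  have inj: "e c = e c' \<longleftrightarrow> c = c'" if "c < ?n" "c' < ?n" for c c'
    using e that by (auto simp: bij_betw_def inj_on_def)
  have at: "X $$ e c = X $$ (fst (e c), snd (e c))" for X :: "'k mat" and c by simp
  have "regular_rep e (1\<^sub>m N :: 'k mat) = 1\<^sub>m ?n"
    by (intro eq_matI)
      (auto simp: regular_rep_def left_mult_one_mat[of _ N N] orbit_mat_reps er inj)
  moreover have "regular_rep e (a * b) = regular_rep e a * regular_rep e b"
    if ab: "a \<in> commutant" "b \<in> commutant" for a b :: "'k mat"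
  proof (rule eq_matI)
    fix c c' assume "c < dim_row (regular_rep e a * regular_rep e b)"
      "c' < dim_col (regular_rep e a * regular_rep e b)"
    then have c: "c < ?n" "c' < ?n" by (auto simp: regular_rep_def)
    note abc = commutant_carrier[OF ab(1)] commutant_carrier[OF ab(2)]
    have "regular_rep e (a * b) $$ (c, c') = (a * (b * orbit_mat (e c'))) $$ e c"
      using c abc by (simp add: regular_rep_def assoc_mult_mat[of _ N N _ N _ N])
    also have "\<dots> = (\<Sum>l<?n. (b * orbit_mat (e c')) $$ e l * (a * orbit_mat (e l)) $$ e c)"
      using left_expand[OF two commutant_mult[OF ab(2) orbit_mat_commutant[OF er[OF c(2)]]]
          abc(1) er[OF c(1)]] sum_reps[OF e] by simp
    also have "\<dots> = (\<Sum>l<?n. regular_rep e a $$ (c, l) * regular_rep e b $$ (l, c'))"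
      using c by (intro sum.cong refl) (simp add: regular_rep_def mult.commute)
    also have "\<dots> = (regular_rep e a * regular_rep e b) $$ (c, c')"
      by (rule index_mult_mat_sum[symmetric]) (use c in \<open>auto simp: regular_rep_def\<close>)
    finally show "regular_rep e (a * b) $$ (c, c') = (regular_rep e a * regular_rep e b) $$ (c, c')" .
  qed (auto simp: regular_rep_def)
  moreover have "regular_rep e (a + b) = regular_rep e a + regular_rep e b"
    if "a \<in> commutant" "b \<in> commutant" for a b :: "'k mat"
    using that[THEN commutant_carrier]
    by (intro eq_matI)
      (auto simp: regular_rep_def add_mult_distrib_mat[of _ N N _ _ N] at eb
        simp del: index_mult_mat(1) prod.collapse)
  moreover have "regular_rep e (x \<cdot>\<^sub>m a) = x \<cdot>\<^sub>m regular_rep e a"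
    if "a \<in> commutant" for a :: "'k mat" and x
    using that[THEN commutant_carrier]
    by (intro eq_matI)
      (auto simp: regular_rep_def mult_smult_assoc_mat[of _ N N _ N] at eb
        simp del: index_mult_mat(1) prod.collapse)
  ultimately show ?thesis by (auto simp: is_module_def regular_rep_def)
qed

text \<open>An endomorphism of the left regular module is the right multiplication by the image
  of \<open>1\<close>.\<close>

lemma mat_trace_regular_endo:
  fixes E Z :: "'k::field mat"
  assumes two: "\<And>a::'k. a + a = 0 \<Longrightarrow> a = 0"
    and e: "bij_betw e {..<card pairs.reps} pairs.reps"
    and E: "E \<in> carrier_mat (card pairs.reps) (card pairs.reps)"
    and comm: "\<And>a. a \<in> commutant \<Longrightarrow> regular_rep e a * E = E * regular_rep e a"
    and Z: "Z \<in> commutant"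
  shows "\<exists>S\<in>commutant. mat_trace (regular_rep e Z * E) = two_sided_trace Z S"
proof -
  let ?n = "card pairs.reps"
  have er: "e c \<in> pairs.reps" if "c < ?n" for c using e that by (auto simp: bij_betw_def)
  have inj: "e c = e c' \<longleftrightarrow> c = c'" if "c < ?n" "c' < ?n" for c c'
    using e that by (auto simp: bij_betw_def inj_on_def)
  have reg: "regular_rep e a \<in> carrier_mat ?n ?n" for a :: "'k mat" by (simp add: regular_rep_def)
  \<comment> \<open>The entries of the unit matrix at the representatives are its coordinates, so
    \<open>t\<close> is the coordinate vector of E(1) and \<open>S\<close> the element E(1)
    itself.\<close>
  define t where "t c = (\<Sum>d<?n. E $$ (c, d) * (1\<^sub>m N :: 'k mat) $$ e d)" for c
  define S where "S = orbit_comb (t \<circ> inv_into {..<?n} e)"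
  have S: "S \<in> commutant" unfolding S_def by (rule orbit_comb_commutant)
  have St: "S $$ e c = t c" if "c < ?n" for c
    using that er e by (simp add: S_def orbit_comb_rep bij_betw_def)
  \<comment> \<open>In coordinates, this is E(O) = E(O 1) = O E(1) for an orbit matrix O;
    \<open>delta\<close> records O 1 = O.\<close>
  have EO: "E $$ (c', c) = (orbit_mat (e c) * S) $$ e c'" if c: "c < ?n" "c' < ?n" for c c'
  proof -
    have oc: "(orbit_mat (e c) :: 'k mat) \<in> commutant" by (rule orbit_mat_commutant[OF er[OF c(1)]])
    have delta: "(\<Sum>d<?n. (1\<^sub>m N :: 'k mat) $$ e d * regular_rep e (orbit_mat (e c)) $$ (l, d))
        = (if l = c then 1 else 0)" if l: "l < ?n" for l
    proof -
      have "(\<Sum>d<?n. (1\<^sub>m N :: 'k mat) $$ e d * regular_rep e (orbit_mat (e c)) $$ (l, d))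
          = (orbit_mat (e c) * 1\<^sub>m N) $$ e l"
        using left_expand[OF two commutant_one commutant_carrier[OF oc] er[OF l]] l
        by (simp add: regular_rep_def sum_reps[OF e])
      also have "\<dots> = (if l = c then 1 else 0)"
        using er inj l c by (auto simp: right_mult_one_mat[of _ N N] orbit_mat_reps)
      finally show ?thesis .
    qed
    have "(orbit_mat (e c) * S) $$ e c' = (\<Sum>d<?n. t d * regular_rep e (orbit_mat (e c)) $$ (c', d))"
      using left_expand[OF two S commutant_carrier[OF oc] er[OF c(2)]] c
      by (simp add: regular_rep_def St sum_reps[OF e])
    also have "\<dots> = (\<Sum>d'<?n. (1\<^sub>m N :: 'k mat) $$ e d' *
        (\<Sum>d<?n. regular_rep e (orbit_mat (e c)) $$ (c', d) * E $$ (d, d')))"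
      unfolding t_def sum_distrib_left sum_distrib_right
      by (subst sum.swap) (simp add: ac_simps)
    also have "\<dots> = (\<Sum>d'<?n. (1\<^sub>m N :: 'k mat) $$ e d' *
        (\<Sum>l<?n. E $$ (c', l) * regular_rep e (orbit_mat (e c)) $$ (l, d')))"
      by (intro sum.cong refl)
        (simp add: index_mult_mat_sum[OF reg E c(2), symmetric]
          index_mult_mat_sum[OF E reg c(2), symmetric] comm[OF oc] del: index_mult_mat(1))
    also have "\<dots> = (\<Sum>l<?n. E $$ (c', l) *
        (\<Sum>d<?n. (1\<^sub>m N :: 'k mat) $$ e d * regular_rep e (orbit_mat (e c)) $$ (l, d)))"
      unfolding sum_distrib_left by (subst sum.swap) (simp add: ac_simps)
    also have "\<dots> = (\<Sum>l<?n. if l = c then E $$ (c', l) else 0)"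
      by (intro sum.cong refl) (simp add: delta)
    also have "\<dots> = E $$ (c', c)" using c by simp
    finally show ?thesis by simp
  qed
  have "mat_trace (regular_rep e Z * E) = (\<Sum>c<?n. \<Sum>c'<?n. regular_rep e Z $$ (c, c') * E $$ (c', c))"
    using index_mult_mat_sum[OF reg E] by (simp add: mat_trace_def regular_rep_def)
  also have "\<dots> = (\<Sum>c<?n. (Z * (orbit_mat (e c) * S)) $$ e c)"
  proof (intro sum.cong refl)
    fix c assume "c \<in> {..<?n}"
    then have c: "c < ?n" by simp
    have "orbit_mat (e c) * S \<in> commutant"
      by (intro commutant_mult orbit_mat_commutant er c S)
    from left_expand[OF two this commutant_carrier[OF Z] er[OF c]]
    show "(\<Sum>c'<?n. regular_rep e Z $$ (c, c') * E $$ (c', c)) = (Z * (orbit_mat (e c) * S)) $$ e c"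
      using c by (simp add: sum_reps[OF e] regular_rep_def EO mult.commute)
  qed
  also have "\<dots> = two_sided_trace Z S"
    unfolding two_sided_trace_def sum_reps[OF e]
    using commutant_carrier[OF Z] commutant_carrier[OF S]
    by (simp add: assoc_mult_mat[of _ N N _ N _ N])
  finally show ?thesis using S by blast
qed

text \<open>The free module on a vector space basis of \<open>P\<close> maps onto \<open>P\<close>,
  and projectivity splits this map. By cyclicity the trace of \<open>Z\<close> on \<open>P\<close>
  is the trace of \<open>Z\<close> on the free module against an idempotent endomorphism, whose
  diagonal blocks are endomorphisms of the regular module.\<close>

lemma mat_trace_projective_eq_0:
  fixes P :: "'k::field fdmod"
  assumes two: "\<And>a::'k. a + a = 0 \<Longrightarrow> a = 0"
    and P: "is_projective N commutant P" and Z: "Z \<in> commutant"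
    and tr: "\<And>S. S \<in> commutant \<Longrightarrow> two_sided_trace Z S = 0"
  shows "mat_trace (snd P Z) = 0"
proof -
  let ?n = "card pairs.reps"
  define r where "r = fst P"
  define \<rho> where "\<rho> = snd P"
  obtain e where e: "bij_betw e {..<?n} pairs.reps"
    using ex_bij_betw_nat_finite[OF pairs.finite_reps] by (auto simp: atLeast0LessThan)
  have er: "e c \<in> pairs.reps" if "c < ?n" for c using e that by (auto simp: bij_betw_def)
  have oe: "(orbit_mat (e c) :: 'k mat) \<in> commutant" if "c < ?n" for c
    by (rule orbit_mat_commutant[OF er[OF that]])
  have M: "is_module N commutant P" by (rule projective_imp_module[OF P])
  have \<rho>c: "\<rho> a \<in> carrier_mat r r" if "a \<in> commutant" for a
    using M that by (simp add: is_module_def r_def \<rho>_def)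
  have \<rho>m: "\<rho> (a * b) = \<rho> a * \<rho> b" if "a \<in> commutant" "b \<in> commutant" for a b
    using M that by (simp add: is_module_def \<rho>_def)
  have \<rho>e: "\<rho> a $$ (i, b) = (\<Sum>c<?n. a $$ e c * \<rho> (orbit_mat (e c)) $$ (i, b))"
    if "a \<in> commutant" "i < r" "b < r" for a i b
    using module_orbit_expand[OF M two that(1)] that sum_reps[OF e] by (simp add: r_def \<rho>_def)
  define X where "X = (?n * r, \<lambda>a. block_copies ?n r (regular_rep e (a :: 'k mat)))"
  have X: "is_module N commutant X"
    unfolding X_def by (rule is_module_block_copies[OF regular_rep_module[OF two e]])
  have Xf: "fst X = ?n * r" "snd X a = block_copies ?n r (regular_rep e a)" for a
    by (simp_all add: X_def)
  \<comment> \<open>The generator of copy b goes to the b-th basis vector of \<open>P\<close>, so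
    the orbit matrix \<open>e c\<close> in copy b goes to column b of its image under the
    representation.\<close>
  define g where "g = mat r (?n * r) (\<lambda>(i, j). \<rho> (orbit_mat (e (j mod ?n))) $$ (i, j div ?n))"
  have gc: "g \<in> carrier_mat r (?n * r)" by (simp add: g_def)
  have gi: "g $$ (i, b * ?n + c) = \<rho> (orbit_mat (e c)) $$ (i, b)"
    if "i < r" "b < r" "c < ?n" for i b c
    using that block_index_bound[of b r c ?n] by (simp add: g_def)
  have ghom: "g * block_copies ?n r (regular_rep e a) = \<rho> a * g" if a: "a \<in> commutant" for a
  proof (rule eq_matI)
    fix i j assume "i < dim_row (\<rho> a * g)" "j < dim_col (\<rho> a * g)"
    then have i: "i < r" and j: "j < ?n * r" using \<rho>c[OF a] gc by auto
    obtain b c where b: "b < r" "c < ?n" "j = b * ?n + c" using block_index_cases[OF j] by blast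
    note ao = commutant_mult[OF a oe[OF b(2)]]
    have "(g * block_copies ?n r (regular_rep e a)) $$ (i, j)
        = (\<Sum>c'<?n. (a * orbit_mat (e c)) $$ e c' * \<rho> (orbit_mat (e c')) $$ (i, b))"
      unfolding b(3) block_copies_mult_right[OF gc b(1,2) i] using b i
      by (intro sum.cong refl) (simp add: gi regular_rep_def mult.commute)
    also have "\<dots> = \<rho> (a * orbit_mat (e c)) $$ (i, b)"
      using \<rho>e[OF ao i b(1)] by simp
    also have "\<dots> = (\<Sum>l<r. \<rho> a $$ (i, l) * \<rho> (orbit_mat (e c)) $$ (l, b))"
      unfolding \<rho>m[OF a oe[OF b(2)]] by (rule index_mult_mat_sum[OF \<rho>c[OF a] \<rho>c[OF oe[OF b(2)]] i b(1)])
    also have "\<dots> = (\<rho> a * g) $$ (i, j)"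
      using index_mult_mat_sum[OF \<rho>c[OF a] gc i j] b by (simp add: gi)
    finally show "(g * block_copies ?n r (regular_rep e a)) $$ (i, j) = (\<rho> a * g) $$ (i, j)" .
  qed (use gc \<rho>c[OF a] in \<open>auto simp: block_copies_def\<close>)
  have hom: "is_mod_hom commutant X P g"
    using gc ghom by (simp add: is_mod_hom_def Xf r_def \<rho>_def)
  have surj: "mat_surj (fst X) (fst P) g"
    unfolding mat_surj_def
  proof (intro ballI bexI)
    fix y :: "'k vec" assume y: "y \<in> carrier_vec (fst P)"
    \<comment> \<open>The preimage of \<open>y\<close> has the unit of the algebra, scaled by the
      b-th coordinate of \<open>y\<close>, in copy b.\<close>
    let ?x = "vec (?n * r) (\<lambda>j. (1\<^sub>m N :: 'k mat) $$ e (j mod ?n) * y $ (j div ?n))"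
    show "?x \<in> carrier_vec (fst X)" by (simp add: Xf)
    show "g *\<^sub>v ?x = y"
    proof (rule eq_vecI)
      fix i assume "i < dim_vec y"
      then have i: "i < r" using y by (simp add: r_def)
      have "(g *\<^sub>v ?x) $ i = (\<Sum>j<?n * r. g $$ (i, j) * ?x $ j)"
        using gc i by (simp add: scalar_prod_def atLeast0LessThan)
      also have "\<dots> = (\<Sum>b<r. \<Sum>c<?n. \<rho> (orbit_mat (e c)) $$ (i, b) * ((1\<^sub>m N :: 'k mat) $$ e c * y $ b))"
        unfolding sum_lessThan_blocks using i block_index_bound
        by (intro sum.cong refl) (simp add: gi)
      also have "\<dots> = (\<Sum>b<r. (\<Sum>c<?n. (1\<^sub>m N :: 'k mat) $$ e c * \<rho> (orbit_mat (e c)) $$ (i, b)) * y $ b)"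
        by (simp add: sum_distrib_left sum_distrib_right ac_simps)
      also have "\<dots> = (\<Sum>b<r. \<rho> (1\<^sub>m N) $$ (i, b) * y $ b)"
        using \<rho>e[OF commutant_one i] by simp
      also have "\<rho> (1\<^sub>m N) = 1\<^sub>m r" using M by (simp add: is_module_def r_def \<rho>_def)
      also have "(\<Sum>b<r. 1\<^sub>m r $$ (i, b) * y $ b) = (\<Sum>b<r. if b = i then y $ b else 0)"
        using i by (intro sum.cong refl) auto
      also have "\<dots> = y $ i" using i by simp
      finally show "(g *\<^sub>v ?x) $ i = y $ i" .
    qed (use gc y r_def in auto)
  qed
  obtain h where h: "is_mod_hom commutant P X h" "g * h = 1\<^sub>m (fst P)"
    using projective_split[OF P X hom surj] .
  have hc: "h \<in> carrier_mat (?n * r) r" using h(1) by (simp add: is_mod_hom_def Xf r_def)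
  have hh: "h * \<rho> a = block_copies ?n r (regular_rep e a) * h" if "a \<in> commutant" for a
    using h(1) that by (simp add: is_mod_hom_def Xf \<rho>_def)
  let ?E = "h * g"
  have Ec: "?E \<in> carrier_mat (?n * r) (?n * r)" using hc gc by simp
  have Ecomm: "block_copies ?n r (regular_rep e a) * ?E = ?E * block_copies ?n r (regular_rep e a)"
    if a: "a \<in> commutant" for a
  proof -
    have "block_copies ?n r (regular_rep e a) * ?E = (h * \<rho> a) * g"
      unfolding hh[OF a] by (rule assoc_mult_mat[symmetric, OF block_copies_carrier hc gc])
    also have "\<dots> = h * (g * block_copies ?n r (regular_rep e a))"
      unfolding ghom[OF a] by (rule assoc_mult_mat[OF hc \<rho>c[OF a] gc])
    also have "\<dots> = ?E * block_copies ?n r (regular_rep e a)"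
      by (rule assoc_mult_mat[symmetric, OF hc gc block_copies_carrier])
    finally show ?thesis .
  qed
  define Eb where "Eb b = mat ?n ?n (\<lambda>(c, c'). ?E $$ (b * ?n + c, b * ?n + c'))" for b
  have Ebc: "Eb b \<in> carrier_mat ?n ?n" for b by (simp add: Eb_def)
  \<comment> \<open>Since the algebra acts on all copies by the same block, commuting with
    \<open>h * g\<close> passes to each diagonal block.\<close>
  have Ebcomm: "regular_rep e a * Eb b = Eb b * regular_rep e a"
    if a: "a \<in> commutant" and b: "b < r" for a b
  proof (rule eq_matI)
    have reg: "regular_rep e a \<in> carrier_mat ?n ?n" by (simp add: regular_rep_def)
    fix c c' assume "c < dim_row (Eb b * regular_rep e a)" "c' < dim_col (Eb b * regular_rep e a)"
    then have c: "c < ?n" "c' < ?n" by (auto simp: Eb_def regular_rep_def)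
    have "(regular_rep e a * Eb b) $$ (c, c') = (block_copies ?n r (regular_rep e a) * ?E) $$ (b * ?n + c, b * ?n + c')"
      using c b block_copies_mult_left[OF Ec b c(1) block_index_bound[OF b c(2)]]
        index_mult_mat_sum[OF reg Ebc c] by (simp add: Eb_def)
    also have "\<dots> = (Eb b * regular_rep e a) $$ (c, c')"
      unfolding Ecomm[OF a]
      using c b block_copies_mult_right[OF Ec b c(2) block_index_bound[OF b c(1)]]
        index_mult_mat_sum[OF Ebc reg c] by (simp add: Eb_def)
    finally show "(regular_rep e a * Eb b) $$ (c, c') = (Eb b * regular_rep e a) $$ (c, c')" .
  qed (auto simp: Eb_def regular_rep_def)
  have "mat_trace (\<rho> Z) = mat_trace (\<rho> Z * (g * h))"
    using \<rho>c[OF Z] h(2) by (simp add: r_def right_mult_one_mat[of _ r r])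
  also have "\<dots> = mat_trace ((\<rho> Z * g) * h)"
    using assoc_mult_mat[OF \<rho>c[OF Z] gc hc] by simp
  also have "\<dots> = mat_trace (g * (block_copies ?n r (regular_rep e Z) * h))"
    unfolding ghom[OF Z, symmetric] using assoc_mult_mat[OF gc block_copies_carrier hc] by simp
  also have "\<dots> = mat_trace (block_copies ?n r (regular_rep e Z) * h * g)"
    by (rule mat_trace_mult_comm[OF gc]) (use hc block_copies_carrier in \<open>rule mult_carrier_mat[rotated]\<close>)
  also have "\<dots> = mat_trace (block_copies ?n r (regular_rep e Z) * ?E)"
    using assoc_mult_mat[OF block_copies_carrier hc gc] by simp
  also have "\<dots> = (\<Sum>b<r. mat_trace (regular_rep e Z * Eb b))"
    unfolding Eb_def by (rule mat_trace_block_copies_mult[OF _ Ec]) (simp add: regular_rep_def)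
  also have "\<dots> = (\<Sum>b<r. 0)"
  proof (intro sum.cong refl)
    fix b assume "b \<in> {..<r}"
    then show "mat_trace (regular_rep e Z * Eb b) = 0"
      using mat_trace_regular_endo[OF two e Ebc Ebcomm Z, of b] tr by auto
  qed
  finally show ?thesis by (simp add: \<rho>_def)
qed

end

section \<open>Tensor words and the odd flip\<close>

definition word_index :: "nat \<Rightarrow> nat \<Rightarrow> (nat \<Rightarrow> nat) \<Rightarrow> nat" where
  "word_index q d f = (\<Sum>l<d. f l * q ^ l)"

lemma word_index_less:
  assumes "\<And>l. l < d \<Longrightarrow> f l < q" shows "word_index q d f < q ^ d"
  using assms
proof (induction d)
  case (Suc d)
  have "word_index q (Suc d) f = word_index q d f + f d * q ^ d" by (simp add: word_index_def)
  also have "\<dots> < q ^ d + f d * q ^ d" using Suc by simp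
  also have "\<dots> = Suc (f d) * q ^ d" by simp
  also have "\<dots> \<le> q * q ^ d" by (rule mult_le_mono1) (use Suc.prems[of d] in simp)
  finally show ?case by simp
qed (simp add: word_index_def)

lemma digit_word_index:
  assumes "\<And>l. l < d \<Longrightarrow> f l < q" "l < d" shows "digit q (word_index q d f) l = f l"
  using assms
proof (induction d)
  case (Suc d)
  have q: "0 < q" using Suc.prems(1)[of d] by simp
  have W: "word_index q (Suc d) f = word_index q d f + f d * q ^ d" by (simp add: word_index_def)
  show ?case
  proof (cases "l = d")
    case True
    have "word_index q d f < q ^ d" by (rule word_index_less) (use Suc.prems in simp)
    then show ?thesis using Suc.prems(1)[of d] q unfolding digit_def W True by simp
  next
    case False
    then have l: "l < d" using Suc.prems by simp
    have "q ^ d = q ^ l * (q * q ^ (d - l - 1))"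
      using l by (simp flip: power_Suc power_add)
    then have "word_index q (Suc d) f = word_index q d f + (f d * q ^ (d - l - 1) * q) * q ^ l"
      unfolding W by (simp add: ac_simps)
    then have "word_index q (Suc d) f div q ^ l
        = f d * q ^ (d - l - 1) * q + word_index q d f div q ^ l"
      using q by simp
    then have "digit q (word_index q (Suc d) f) l = digit q (word_index q d f) l"
      unfolding digit_def by simp
    then show ?thesis using Suc l by simp
  qed
qed simp

lemma word_index_digit: "word_index q d (digit q t) = t mod q ^ d"
proof (induction d)
  case (Suc d)
  have "t mod (q ^ d * q) = q ^ d * (t div q ^ d mod q) + t mod q ^ d" by (rule mod_mult2_eq)
  then show ?case using Suc by (simp add: word_index_def digit_def ac_simps)
qed (simp add: word_index_def)

lemma word_eqI:
  assumes "t < q ^ d" "u < q ^ d" "\<And>l. l < d \<Longrightarrow> digit q t l = digit q u l"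
  shows "t = u"
proof -
  have "word_index q d (digit q t) = word_index q d (digit q u)"
    unfolding word_index_def using assms(3) by simp
  then show ?thesis using assms(1,2) by (simp add: word_index_digit)
qed

lemma digit_less: "0 < q \<Longrightarrow> digit q t l < q"
  by (simp add: digit_def)

lemma swap_idx_word_index: "swap_idx q d j t = word_index q d (\<lambda>l. digit q t (transpose j (Suc j) l))"
  by (simp add: swap_idx_def word_index_def)

lemma swap_idx_less: "0 < q \<Longrightarrow> swap_idx q d j t < q ^ d"
  unfolding swap_idx_word_index by (rule word_index_less) (rule digit_less)

lemma digit_swap_idx:
  "0 < q \<Longrightarrow> l < d \<Longrightarrow> digit q (swap_idx q d j t) l = digit q t (transpose j (Suc j) l)"
  unfolding swap_idx_word_index by (rule digit_word_index) (auto intro: digit_less)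

lemma transpose_Suc_less: "Suc j < d \<Longrightarrow> transpose j (Suc j) l < d \<longleftrightarrow> l < d"
  by (auto simp: transpose_def)

lemma swap_idx_invol:
  assumes "0 < q" "Suc j < d" "t < q ^ d"
  shows "swap_idx q d j (swap_idx q d j t) = t"
proof (rule word_eqI)
  fix l assume "l < d"
  then show "digit q (swap_idx q d j (swap_idx q d j t)) l = digit q t l"
    using assms by (simp add: digit_swap_idx transpose_Suc_less)
qed (use assms swap_idx_less in auto)

lemma super_sign_swap:
  assumes "0 < m + n" "Suc j < d"
  shows "super_sign m n j (swap_idx (m + n) d j t) = super_sign m n j t"
  using assms by (auto simp: super_sign_def digit_swap_idx transpose_def)

lemma super_sign_square: "super_sign m n j t * super_sign m n j t = (1 :: 'a::ring_1)"
  by (simp add: super_sign_def)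

text \<open>\<open>n_two\<close> provides a second odd letter \<open>Suc m\<close> beside
  \<open>m\<close>; it fills the places outside gl(1|1).\<close>

locale super_words =
  fixes m n d :: nat
  assumes m_pos: "1 \<le> m" and n_two: "2 \<le> n"
begin

abbreviation "q \<equiv> m + n"
abbreviation "letter t l \<equiv> digit q t l"
abbreviation "swp j t \<equiv> swap_idx q d j t"
abbreviation "sgn_at j t \<equiv> (super_sign m n j t :: int)"

lemma q_pos: "0 < q" using m_pos by simp

sublocale signed_action "tensor_dim m n d" "{j. Suc j < d}" "swap_idx (m + n) d" "super_sign m n"
proof
  fix j x assume "j \<in> {j. Suc j < d}" "x < tensor_dim m n d"
  then have "Suc j < d" "x < q ^ d" by (auto simp: tensor_dim_def)
  then show "swp j x < tensor_dim m n d" "swp j (swp j x) = x" "sgn_at j (swp j x) = sgn_at j x"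
    "sgn_at j x * sgn_at j x = 1"
    using q_pos swap_idx_less[of q d j x]
    by (simp_all add: tensor_dim_def swap_idx_invol super_sign_swap super_sign_square)
qed

lemma of_int_super_sign: "of_int (super_sign m n j t) = super_sign m n j t"
  by (simp add: super_sign_def)

text \<open>\<open>swap_mat\<close> is a signed permutation matrix that is its own inverse: the
  commutation relation at (x, y) is the invariance relation with one index swapped, and the sign
  moves to the other side because its square is 1.\<close>

lemma schur_superalgebra_eq_commutant: "(schur_superalgebra m n d :: 'k::field mat set) = commutant"
proof -
  let ?N = "tensor_dim m n d"
  have "M * swap_mat m n d j = swap_mat m n d j * M \<longleftrightarrow>
      (\<forall>x<?N. \<forall>y<?N. M $$ (swp j x, swp j y)
        = of_int (super_sign m n j x * super_sign m n j y) * M $$ (x, y))"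
    (is "_ \<longleftrightarrow> ?R")
    if M: "M \<in> carrier_mat ?N ?N" and j: "Suc j < d" for M :: "'k mat" and j
  proof -
    have c: "swp j x < ?N" "swp j (swp j x) = x" if "x < ?N" for x
      using act_closed act_invol j that by auto
    have s: "super_sign m n j (swp j x) = (super_sign m n j x :: 'k)" for x
      by (rule super_sign_swap[OF q_pos j])
    have S: "swap_mat m n d j \<in> carrier_mat ?N ?N" by (simp add: swap_mat_def)
    have L: "(M * swap_mat m n d j) $$ (x, y) = M $$ (x, swp j y) * super_sign m n j y"
      if "x < ?N" "y < ?N" for x y
    proof -
      have "(M * swap_mat m n d j) $$ (x, y)
          = (\<Sum>l<?N. if l = swp j y then M $$ (x, l) * super_sign m n j y else 0)"
        unfolding index_mult_mat_sum[OF M S that]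
        using that by (intro sum.cong refl) (auto simp: swap_mat_def)
      then show ?thesis using c that by simp
    qed
    have R: "(swap_mat m n d j * M) $$ (x, y) = super_sign m n j x * M $$ (swp j x, y)"
      if "x < ?N" "y < ?N" for x y
    proof -
      have "x = swp j l \<longleftrightarrow> l = swp j x" if "l < ?N" for l
        using c that \<open>x < ?N\<close> by metis
      then have "(swap_mat m n d j * M) $$ (x, y)
          = (\<Sum>l<?N. if l = swp j x then super_sign m n j x * M $$ (l, y) else 0)"
        unfolding index_mult_mat_sum[OF S M that]
        using that by (intro sum.cong refl) (auto simp: swap_mat_def s)
      then show ?thesis using c that by simp
    qed
    have "M * swap_mat m n d j = swap_mat m n d j * M \<longleftrightarrow>
      (\<forall>x<?N. \<forall>y<?N. (M * swap_mat m n d j) $$ (x, y) = (swap_mat m n d j * M) $$ (x, y))"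
      using M S by (auto simp: mat_eq_iff simp del: index_mult_mat(1))
    also have "\<dots> \<longleftrightarrow> (\<forall>x<?N. \<forall>y<?N. M $$ (x, swp j y) * super_sign m n j y
        = super_sign m n j x * M $$ (swp j x, y))"
      by (simp add: L R del: index_mult_mat(1))
    also have "\<dots> \<longleftrightarrow> ?R"
    proof (intro iffI allI impI)
      fix x y assume *: "\<forall>x<?N. \<forall>y<?N. M $$ (x, swp j y) * super_sign m n j y
        = super_sign m n j x * M $$ (swp j x, y)" and x: "x < ?N" "y < ?N"
      have "M $$ (swp j x, swp j y) * super_sign m n j y = super_sign m n j x * M $$ (x, y)"
        using * c x s by metis
      then have "M $$ (swp j x, swp j y) * (super_sign m n j y * super_sign m n j y)
          = super_sign m n j x * M $$ (x, y) * super_sign m n j y"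
        by (simp only: mult.assoc[symmetric])
      then show "M $$ (swp j x, swp j y)
        = of_int (super_sign m n j x * super_sign m n j y) * M $$ (x, y)"
        by (simp add: super_sign_square of_int_super_sign ac_simps)
    next
      fix x y assume *: ?R and x: "x < ?N" "y < ?N"
      have "M $$ (x, swp j y) = super_sign m n j x * super_sign m n j y * M $$ (swp j x, y)"
        using *[rule_format, OF c(1)[OF x(1)] x(2)] c x s by (simp add: of_int_super_sign)
      then have "M $$ (x, swp j y) * super_sign m n j y
          = super_sign m n j x * M $$ (swp j x, y) * (super_sign m n j y * super_sign m n j y)"
        by (simp only: ac_simps)
      then show "M $$ (x, swp j y) * super_sign m n j y = super_sign m n j x * M $$ (swp j x, y)"
        by (simp only: super_sign_square mult_1_right)
    qed
    finally show ?thesis .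
  qed
  then show ?thesis by (auto simp: schur_superalgebra_def commutant_def)
qed

text \<open>The letters \<open>0\<close> (even) and \<open>m\<close> (odd) span a copy of \<open>gl(1|1)\<close>; \<open>odd_flip\<close> is the action of
  the odd element exchanging them, with the Koszul sign of the letters it passes. Its square
  counts these letters.\<close>

abbreviation ab_letter :: "nat \<Rightarrow> bool" where
  "ab_letter x \<equiv> x = 0 \<or> x = m"

definition flip_letter :: "nat \<Rightarrow> nat" where
  "flip_letter x = (if x = 0 then m else if x = m then 0 else x)"

definition flip_at :: "nat \<Rightarrow> nat \<Rightarrow> nat" where
  "flip_at l t = word_index q d (\<lambda>i. if i = l then flip_letter (letter t i) else letter t i)"

definition parity_sign :: "nat \<Rightarrow> int" where
  "parity_sign x = (if m \<le> x then - 1 else 1)"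

definition koszul_sign :: "nat \<Rightarrow> nat \<Rightarrow> int" where
  "koszul_sign l t = (\<Prod>i<l. parity_sign (letter t i))"

definition flip_coeff :: "nat \<Rightarrow> nat \<Rightarrow> int" where
  "flip_coeff l t = (if ab_letter (letter t l) then koszul_sign l t else 0)"

definition odd_flip :: "int mat" where
  "odd_flip = mat (tensor_dim m n d) (tensor_dim m n d)
     (\<lambda>(x, y). \<Sum>l<d. if x = flip_at l y then flip_coeff l y else 0)"

definition ab_count :: "nat \<Rightarrow> int" where
  "ab_count t = (\<Sum>l<d. if ab_letter (letter t l) then 1 else 0)"

text \<open>The entries of the diagonal matrix whose trace on a module is the alternating sum of the
  dimensions of the weight spaces \<open>0\<^bsup>p-j\<^esup> m\<^sup>j (m+1)\<^bsup>d-p\<^esup>\<close>.\<close>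

definition signed_weight :: "nat \<Rightarrow> nat \<Rightarrow> int" where
  "signed_weight p t = (if ab_count t = int p \<and> (\<forall>l<d. ab_letter (letter t l) \<or> letter t l = Suc m)
     then \<Prod>l<d. if letter t l = m then - 1 else 1 else 0)"

lemma parity_sign_square [simp]: "parity_sign x * parity_sign x = 1"
  by (simp add: parity_sign_def)

lemma koszul_sign_square: "koszul_sign l t * koszul_sign l t = 1"
  by (simp add: koszul_sign_def flip: prod.distrib)

lemma koszul_sign_Suc: "koszul_sign (Suc l) t = koszul_sign l t * parity_sign (letter t l)"
  by (simp add: koszul_sign_def)

lemma flip_letter_less: "x < q \<Longrightarrow> flip_letter x < q"
  using m_pos n_two by (auto simp: flip_letter_def)

lemma flip_letter_invol [simp]: "flip_letter (flip_letter x) = x"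
  by (simp add: flip_letter_def)

lemma ab_letter_flip [simp]: "ab_letter (flip_letter x) \<longleftrightarrow> ab_letter x"
  by (auto simp: flip_letter_def)

lemma parity_sign_flip: "ab_letter x \<Longrightarrow> parity_sign (flip_letter x) = - parity_sign x"
  using m_pos by (auto simp: flip_letter_def parity_sign_def)

lemma letter_less: "letter t l < q"
  using q_pos by (rule digit_less)

lemma flip_at_less: "flip_at l t < tensor_dim m n d"
  unfolding flip_at_def tensor_dim_def
  by (rule word_index_less) (simp add: flip_letter_less letter_less)

lemma letter_flip_at:
  "i < d \<Longrightarrow> letter (flip_at l t) i = (if i = l then flip_letter (letter t i) else letter t i)"
  unfolding flip_at_def by (rule digit_word_index) (auto simp: flip_letter_less letter_less)

lemma letter_swp: "l < d \<Longrightarrow> letter (swp j t) l = letter t (transpose j (Suc j) l)"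
  by (rule digit_swap_idx[OF q_pos])

lemma words_eqI:
  assumes "t < tensor_dim m n d" "u < tensor_dim m n d" "\<And>l. l < d \<Longrightarrow> letter t l = letter u l"
  shows "t = u"
  using word_eqI assms by (simp add: tensor_dim_def)

lemma swp_less: "swp j t < tensor_dim m n d"
  unfolding tensor_dim_def by (rule swap_idx_less[OF q_pos])

lemma flip_at_swp:
  assumes j: "Suc j < d" and l: "l < d"
  shows "flip_at (transpose j (Suc j) l) (swp j t) = swp j (flip_at l t)"
proof (rule words_eqI)
  fix i assume i: "i < d"
  have "i = transpose j (Suc j) l \<longleftrightarrow> transpose j (Suc j) i = l"
    by (auto simp: transpose_def)
  then show "letter (flip_at (transpose j (Suc j) l) (swp j t)) i = letter (swp j (flip_at l t)) i"
    using i j by (simp add: letter_flip_at letter_swp transpose_Suc_less)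
qed (auto simp: flip_at_less swp_less)

lemma koszul_sign_swp_below:
  assumes "l \<le> j" "Suc j < d" shows "koszul_sign l (swp j t) = koszul_sign l t"
  unfolding koszul_sign_def using assms by (intro prod.cong refl) (auto simp: letter_swp transpose_def)

lemma koszul_sign_swp_above:
  assumes "Suc j < l" "l \<le> d" shows "koszul_sign l (swp j t) = koszul_sign l t"
proof -
  have "koszul_sign l (swp j t) = (\<Prod>i<l. parity_sign (letter t (transpose j (Suc j) i)))"
    unfolding koszul_sign_def using assms by (intro prod.cong refl) (simp add: letter_swp)
  also have "\<dots> = koszul_sign l t"
    unfolding koszul_sign_def
    by (rule prod.reindex_bij_witness[where i = "transpose j (Suc j)" and j = "transpose j (Suc j)"])
      (use assms in \<open>auto simp: transpose_Suc_less\<close>)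
  finally show ?thesis .
qed

text \<open>If the flipped letter is not one of the two swapped ones, neither sign changes.
  Otherwise it passes its neighbour and the Koszul sign changes by the parity of that neighbour; the
  swap sign changes by the same factor, because the flip changes the parity of the other letter of
  the pair.\<close>

lemma koszul_sign_swp:
  assumes j: "Suc j < d" and l: "l < d" and ab: "ab_letter (letter t l)"
  shows "koszul_sign (transpose j (Suc j) l) (swp j t)
    = sgn_at j (flip_at l t) * sgn_at j t * koszul_sign l t"
proof -
  consider "l < j" | "l = j" | "l = Suc j" | "Suc j < l" by linarith
  then show ?thesis
  proof cases
    case 1
    then have "sgn_at j (flip_at l t) = sgn_at j t" using j by (simp add: super_sign_def letter_flip_at)
    then show ?thesis using 1 j by (simp add: koszul_sign_swp_below super_sign_square)
  next
    case 2
    have "sgn_at j (flip_at l t) * sgn_at j t = parity_sign (letter t (Suc j))"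
      using 2 j ab m_pos by (auto simp: super_sign_def letter_flip_at parity_sign_def flip_letter_def)
    then show ?thesis using 2 j by (simp add: koszul_sign_swp_below koszul_sign_Suc letter_swp)
  next
    case 3
    have "sgn_at j (flip_at l t) * sgn_at j t = parity_sign (letter t j)"
      using 3 j ab m_pos by (auto simp: super_sign_def letter_flip_at parity_sign_def flip_letter_def)
    then show ?thesis
      using 3 j by (simp add: koszul_sign_swp_below koszul_sign_Suc mult.left_commute)
  next
    case 4
    then have "sgn_at j (flip_at l t) = sgn_at j t" using j by (simp add: super_sign_def letter_flip_at)
    then show ?thesis using 4 j l by (simp add: koszul_sign_swp_above super_sign_square)
  qed
qed

lemma odd_flip_commutant: "odd_flip \<in> commutant"
proof -
  let ?N = "tensor_dim m n d"
  have "odd_flip $$ (swp j x, swp j y) = sgn_at j x * sgn_at j y * odd_flip $$ (x, y)"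
    if j: "Suc j < d" and x: "x < ?N" "y < ?N" for j x y
  proof -
    have "odd_flip $$ (swp j x, swp j y)
        = (\<Sum>l<d. if swp j x = flip_at l (swp j y) then flip_coeff l (swp j y) else 0)"
      using swp_less by (simp add: odd_flip_def)
    \<comment> \<open>A flip at l followed by the swap equals the swap followed by a flip at the
      transposed place, so the places are reindexed.\<close>
    also have "\<dots> = (\<Sum>l<d. if swp j x = flip_at (transpose j (Suc j) l) (swp j y)
        then flip_coeff (transpose j (Suc j) l) (swp j y) else 0)"
      by (rule sum.reindex_bij_witness[where i = "transpose j (Suc j)" and j = "transpose j (Suc j)"])
        (use j in \<open>auto simp: transpose_Suc_less\<close>)
    also have "\<dots> = (\<Sum>l<d. sgn_at j x * sgn_at j y * (if x = flip_at l y then flip_coeff l y else 0))"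
    proof (intro sum.cong refl)
      fix l assume "l \<in> {..<d}"
      then have l: "l < d" by simp
      have "swp j x = swp j (flip_at l y) \<longleftrightarrow> x = flip_at l y"
        using act_invol[of j] j x flip_at_less by (metis mem_Collect_eq)
      moreover have "flip_coeff (transpose j (Suc j) l) (swp j y)
          = sgn_at j (flip_at l y) * sgn_at j y * flip_coeff l y"
        using l j koszul_sign_swp[OF j l, of y]
        by (simp add: flip_coeff_def letter_swp transpose_Suc_less)
      ultimately show "(if swp j x = flip_at (transpose j (Suc j) l) (swp j y)
          then flip_coeff (transpose j (Suc j) l) (swp j y) else 0)
          = sgn_at j x * sgn_at j y * (if x = flip_at l y then flip_coeff l y else 0)"
        by (simp add: flip_at_swp[OF j l])
    qed
    also have "\<dots> = sgn_at j x * sgn_at j y * odd_flip $$ (x, y)"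
      using x by (simp add: odd_flip_def sum_distrib_left)
    finally show ?thesis .
  qed
  then show ?thesis by (simp add: commutant_def odd_flip_def)
qed

lemma flip_at_flip_at:
  assumes "t < tensor_dim m n d" "l < d" shows "flip_at l (flip_at l t) = t"
  by (rule words_eqI) (use assms in \<open>auto simp: flip_at_less letter_flip_at\<close>)

lemma flip_at_commute: "flip_at l (flip_at l' t) = flip_at l' (flip_at l t)"
  by (rule words_eqI) (auto simp: flip_at_less letter_flip_at)

lemma flip_coeff_flip_above:
  assumes "l < l'" "l' < d" "ab_letter (letter t l)"
  shows "flip_coeff l' (flip_at l t) = - flip_coeff l' t"
proof -
  have "koszul_sign l' (flip_at l t) = - koszul_sign l' t"
  proof -
    have l: "l \<in> {..<l'}" using assms by simp
    have "koszul_sign l' (flip_at l t)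
        = parity_sign (flip_letter (letter t l)) * (\<Prod>i\<in>{..<l'} - {l}. parity_sign (letter t i))"
      unfolding koszul_sign_def prod.remove[OF finite_lessThan l]
      using assms by (auto simp: letter_flip_at intro!: prod.cong arg_cong2[where f = "(*)"])
    also have "\<dots> = - koszul_sign l' t"
      unfolding koszul_sign_def prod.remove[OF finite_lessThan l]
      by (simp add: parity_sign_flip[OF assms(3)])
    finally show ?thesis .
  qed
  then show ?thesis using assms by (simp add: flip_coeff_def letter_flip_at)
qed

lemma flip_coeff_flip_below:
  assumes "l < l'" "l' < d" shows "flip_coeff l (flip_at l' t) = flip_coeff l t"
proof -
  have "koszul_sign l (flip_at l' t) = koszul_sign l t"
    unfolding koszul_sign_def using assms by (intro prod.cong refl) (auto simp: letter_flip_at)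
  then show ?thesis using assms by (simp add: flip_coeff_def letter_flip_at)
qed

text \<open>A flip at the lower place changes the parity of one letter passed by the higher flip,
  while the lower flip does not see the higher one. Exactly one of the two orders picks up a
  sign.\<close>

lemma flip_coeff_anticommute:
  assumes "l \<noteq> l'" "l < d" "l' < d"
  shows "flip_coeff l' t * flip_coeff l (flip_at l' t) = - (flip_coeff l t * flip_coeff l' (flip_at l t))"
proof -
  have *: "flip_coeff b t * flip_coeff a (flip_at b t) = - (flip_coeff a t * flip_coeff b (flip_at a t))"
    if "a < b" "b < d" for a b
  proof (cases "ab_letter (letter t a)")
    case True
    then show ?thesis
      using flip_coeff_flip_above[OF that, of t] flip_coeff_flip_below[OF that, of t] by simp
  next
    case False
    then have "flip_coeff a t = 0" by (simp add: flip_coeff_def)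
    then show ?thesis using flip_coeff_flip_below[OF that, of t] by simp
  qed
  from assms(1) consider "l < l'" | "l' < l" by linarith
  then show ?thesis using *[of l l'] *[of l' l] assms by cases auto
qed

lemma flip_coeff_square:
  assumes "l < d" shows "flip_coeff l t * flip_coeff l (flip_at l t) = (if ab_letter (letter t l) then 1 else 0)"
proof -
  have "koszul_sign l (flip_at l t) = koszul_sign l t"
    unfolding koszul_sign_def using assms by (intro prod.cong refl) (auto simp: letter_flip_at)
  then show ?thesis using assms by (simp add: flip_coeff_def letter_flip_at koszul_sign_square)
qed

text \<open>Two flips at different places cancel against the same flips in the other order; two
  flips at the same place restore the word, with coefficient 1 for each letter of gl(1|1).\<close>

lemma odd_flip_square: "odd_flip * odd_flip = mat_diag (tensor_dim m n d) ab_count"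
proof (rule eq_matI)
  let ?N = "tensor_dim m n d"
  fix x y assume "x < dim_row (mat_diag ?N ab_count)" "y < dim_col (mat_diag ?N ab_count)"
  then have x: "x < ?N" "y < ?N" by (auto simp: mat_diag_def)
  define T where "T l l' = (if x = flip_at l (flip_at l' y)
      then flip_coeff l' y * flip_coeff l (flip_at l' y) else 0)" for l l'
  have c: "odd_flip \<in> carrier_mat ?N ?N" by (simp add: odd_flip_def)
  have "(odd_flip * odd_flip) $$ (x, y) = (\<Sum>u<?N. (\<Sum>l<d. if x = flip_at l u then flip_coeff l u else 0)
      * (\<Sum>l<d. if u = flip_at l y then flip_coeff l y else 0))"
    unfolding index_mult_mat_sum[OF c c x] using x by (simp add: odd_flip_def)
  also have "\<dots> = (\<Sum>u<?N. \<Sum>l<d. \<Sum>l'<d. if u = flip_at l' y then T l l' else 0)"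
    unfolding sum_product by (intro sum.cong refl) (auto simp: T_def)
  also have "\<dots> = (\<Sum>l<d. \<Sum>l'<d. \<Sum>u<?N. if u = flip_at l' y then T l l' else 0)"
    by (rule trans[OF sum.swap], rule sum.cong[OF refl], rule sum.swap)
  also have "\<dots> = (\<Sum>l<d. \<Sum>l'<d. T l l')"
    using flip_at_less by simp
  finally have S: "(odd_flip * odd_flip) $$ (x, y) = (\<Sum>l<d. \<Sum>l'<d. T l l')" .
  \<comment> \<open>Adding the double sum to its transpose makes the cancellation termwise; the
    factor 2 is cancelled in the integers.\<close>
  have "2 * (\<Sum>l<d. \<Sum>l'<d. T l l') = (\<Sum>l<d. \<Sum>l'<d. T l l') + (\<Sum>l<d. \<Sum>l'<d. T l' l)"
    by (subst (3) sum.swap) simp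
  also have "\<dots> = (\<Sum>l<d. \<Sum>l'<d. T l l' + T l' l)" by (simp add: sum.distrib)
  also have "\<dots> = (\<Sum>l<d. \<Sum>l'<d. if l = l' then 2 * T l l else 0)"
  proof (intro sum.cong refl)
    fix l l' assume "l \<in> {..<d}" "l' \<in> {..<d}"
    then show "T l l' + T l' l = (if l = l' then 2 * T l l else 0)"
      using flip_coeff_anticommute[of l l' y] unfolding T_def flip_at_commute[of l' l]
      by (cases "l = l'") simp_all
  qed
  also have "\<dots> = 2 * (\<Sum>l<d. T l l)" by (simp add: sum_distrib_left)
  also have "(\<Sum>l<d. T l l) = (if x = y then ab_count y else 0)"
    using x by (simp add: T_def flip_at_flip_at flip_coeff_square ab_count_def)
  finally show "(odd_flip * odd_flip) $$ (x, y) = mat_diag ?N ab_count $$ (x, y)"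
    using S x by (simp add: mat_diag_def del: index_mult_mat(1))
qed (auto simp: odd_flip_def mat_diag_def)

section \<open>The alternating weight trace and its vanishing on projective modules\<close>

definition weight_mat :: "nat \<Rightarrow> int mat" where
  "weight_mat p = mat_diag (tensor_dim m n d) (signed_weight p)"

lemma weight_mat_carrier: "weight_mat p \<in> carrier_mat (tensor_dim m n d) (tensor_dim m n d)"
  by (simp add: weight_mat_def)

lemma odd_flip_sq_weight: "odd_flip * (odd_flip * weight_mat p) = int p \<cdot>\<^sub>m weight_mat p"
proof -
  let ?N = "tensor_dim m n d"
  have c: "odd_flip \<in> carrier_mat ?N ?N" by (simp add: odd_flip_def)
  have "odd_flip * (odd_flip * weight_mat p) = mat_diag ?N ab_count * weight_mat p"
    using assoc_mult_mat[OF c c weight_mat_carrier] by (simp add: odd_flip_square)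
  also have "\<dots> = int p \<cdot>\<^sub>m weight_mat p"
    unfolding weight_mat_def mat_diag_mult_left[OF mat_diag_dim]
    by (intro eq_matI) (auto simp: mat_diag_def signed_weight_def)
  finally show ?thesis .
qed

text \<open>The flip keeps the number of gl(1|1) letters and all letters \<open>Suc m\<close>, but
  changes the number of letters \<open>m\<close> by one.\<close>

lemma signed_weight_flip:
  assumes l: "l < d" and ab: "ab_letter (letter t l)"
  shows "signed_weight p (flip_at l t) = - signed_weight p t"
proof -
  let ?s = "\<lambda>x. if x = m then - 1 else 1 :: int"
  have ab': "ab_letter (letter (flip_at l t) i) \<longleftrightarrow> ab_letter (letter t i)" if "i < d" for i
    using that by (simp add: letter_flip_at)
  have S: "letter (flip_at l t) i = Suc m \<longleftrightarrow> letter t i = Suc m" if "i < d" for i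
    using that by (auto simp: letter_flip_at flip_letter_def)
  have "ab_count (flip_at l t) = ab_count t"
    unfolding ab_count_def by (intro sum.cong refl) (simp add: ab')
  moreover have "(\<Prod>i<d. ?s (letter (flip_at l t) i)) = - (\<Prod>i<d. ?s (letter t i))"
  proof -
    have l': "l \<in> {..<d}" using l by simp
    have "(\<Prod>i\<in>{..<d} - {l}. ?s (letter (flip_at l t) i)) = (\<Prod>i\<in>{..<d} - {l}. ?s (letter t i))"
      by (intro prod.cong refl) (auto simp: letter_flip_at)
    moreover have "?s (letter (flip_at l t) l) = - ?s (letter t l)"
      using ab l m_pos by (auto simp: letter_flip_at flip_letter_def)
    ultimately show ?thesis
      unfolding prod.remove[OF finite_lessThan l'] by simp
  qed
  ultimately show ?thesis by (simp add: signed_weight_def ab' S)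
qed

lemma weight_odd_flip: "weight_mat p * odd_flip = (- 1) \<cdot>\<^sub>m (odd_flip * weight_mat p)"
proof -
  let ?N = "tensor_dim m n d"
  have c: "odd_flip \<in> carrier_mat ?N ?N" by (simp add: odd_flip_def)
  have "signed_weight p x * odd_flip $$ (x, y) = - (odd_flip $$ (x, y) * signed_weight p y)"
    if "x < ?N" "y < ?N" for x y
  proof -
    have "signed_weight p x * odd_flip $$ (x, y)
        = (\<Sum>l<d. signed_weight p x * (if x = flip_at l y then flip_coeff l y else 0))"
      using that by (simp add: odd_flip_def sum_distrib_left)
    also have "\<dots> = (\<Sum>l<d. - ((if x = flip_at l y then flip_coeff l y else 0) * signed_weight p y))"
      by (intro sum.cong refl) (auto simp: flip_coeff_def signed_weight_flip)
    also have "\<dots> = - (odd_flip $$ (x, y) * signed_weight p y)"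
      using that by (simp add: odd_flip_def sum_distrib_right sum_negf)
    finally show ?thesis .
  qed
  then show ?thesis
    unfolding weight_mat_def mat_diag_mult_left[OF c] mat_diag_mult_right[OF c]
    by (intro eq_matI) auto
qed

lemma signed_weight_swp:
  assumes j: "Suc j < d" shows "signed_weight p (swp j t) = signed_weight p t"
proof -
  let ?\<tau> = "transpose j (Suc j)"
  have "ab_count (swp j t) = ab_count t"
    unfolding ab_count_def
    by (rule sum.reindex_bij_witness[where i = ?\<tau> and j = ?\<tau>])
      (use j in \<open>auto simp: transpose_Suc_less letter_swp\<close>)
  moreover have "(\<Prod>l<d. if letter (swp j t) l = m then - 1 else 1 :: int)
      = (\<Prod>l<d. if letter t l = m then - 1 else 1)"
    by (rule prod.reindex_bij_witness[where i = ?\<tau> and j = ?\<tau>])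
      (use j in \<open>auto simp: transpose_Suc_less letter_swp\<close>)
  moreover have "(\<forall>l<d. ab_letter (letter (swp j t) l) \<or> letter (swp j t) l = Suc m)
      \<longleftrightarrow> (\<forall>l<d. ab_letter (letter t l) \<or> letter t l = Suc m)"
  proof -
    have "(\<forall>l<d. Q (?\<tau> l)) \<longleftrightarrow> (\<forall>l<d. Q l)" for Q
      using transpose_Suc_less[OF j] transpose_involutory by metis
    from this[of "\<lambda>l. ab_letter (letter t l) \<or> letter t l = Suc m"] show ?thesis
      by (simp add: letter_swp)
  qed
  ultimately show ?thesis by (simp only: signed_weight_def)
qed

lemma weight_mat_commutant: "weight_mat p \<in> commutant"
proof -
  have "swp j x = swp j y \<longleftrightarrow> x = y"
    if "Suc j < d" "x < tensor_dim m n d" "y < tensor_dim m n d" for j x y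
    using act_invol[of j] that by (metis mem_Collect_eq)
  then show ?thesis
    by (auto simp: commutant_def weight_mat_def mat_diag_def swp_less signed_weight_swp
        super_sign_square)
qed

text \<open>The constant by which \<open>odd_flip\<close> squares is the integer p, nonzero even
  when p vanishes in the field.\<close>

lemma mat_trace_weight_projective_eq_0:
  fixes P :: "'k::field fdmod"
  assumes two: "\<And>a::'k. a + a = 0 \<Longrightarrow> a = 0" and p: "p \<noteq> 0"
    and P: "is_projective (tensor_dim m n d) commutant P"
  shows "mat_trace (snd P (map_mat of_int (weight_mat p))) = 0"
proof (rule mat_trace_projective_eq_0[OF two P])
  show "map_mat of_int (weight_mat p) \<in> (commutant :: 'k mat set)"
    using weight_mat_commutant[of p] act_closed by (auto simp: commutant_def)
  show "two_sided_trace (map_mat of_int (weight_mat p)) S = 0" if "S \<in> commutant" for S :: "'k mat"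
    by (rule two_sided_trace_eq_0[OF two odd_flip_commutant weight_mat_commutant that
          weight_odd_flip odd_flip_sq_weight]) (use p in auto)
qed

end

section \<open>Words with a constant prefix\<close>

lemma funpow_invariant_set: "(\<And>v. v \<in> W \<Longrightarrow> R v \<in> W) \<Longrightarrow> w \<in> W \<Longrightarrow> (R ^^ i) w \<in> W"
  by (induction i) auto

text \<open>By Bezout some multiple of the period k exceeds a multiple of the period p by exactly
  1.\<close>

lemma funpow_period_prime:
  fixes p k :: nat
  assumes p: "prime p" and per: "(R ^^ p) w = w" and k: "0 < k" "k < p" and per_k: "(R ^^ k) w = w"
  shows "R w = w"
proof -
  have "coprime k p" using p k by (meson coprime_commute nat_dvd_not_less prime_imp_coprime)
  then obtain x y where xy: "k * x = p * y + 1" using bezout_nat[of k p] k by auto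
  have mult: "(R ^^ (n * x)) w = w" if "(R ^^ n) w = w" for n x
  proof (induction x)
    case (Suc x)
    then show ?case using that by (simp add: funpow_add)
  qed simp
  have "w = (R ^^ (p * y + 1)) w" using mult[OF per_k, of x] xy by simp
  also have "\<dots> = R ((R ^^ (p * y)) w)" by simp
  finally show ?thesis using mult[OF per, of y] by simp
qed

text \<open>Without fixed points every orbit has exactly p elements and contributes p times a
  constant, that is 0. The induction removes one orbit at a time.\<close>

lemma sum_prime_orbits_eq_0:
  fixes h :: "'x \<Rightarrow> 'a::comm_ring_1"
  assumes p: "prime p" and char: "of_nat p = (0::'a)" and fin: "finite W"
    and R: "\<And>v. v \<in> W \<Longrightarrow> R v \<in> W" and per: "\<And>v. v \<in> W \<Longrightarrow> (R ^^ p) v = v"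
    and nofix: "\<And>v. v \<in> W \<Longrightarrow> R v \<noteq> v" and h: "\<And>v. v \<in> W \<Longrightarrow> h (R v) = h v"
  shows "sum h W = 0"
  using fin R per nofix h
proof (induction W rule: finite_psubset_induct)
  case (psubset W)
  show ?case
  proof (cases "W = {}")
    case False
    then obtain w where w: "w \<in> W" by blast
    let ?O = "(\<lambda>i. (R ^^ i) w) ` {..<p}"
    have p0: "0 < p" using p prime_gt_0_nat by blast
    have OW: "?O \<subseteq> W" using funpow_invariant_set[of W R w] psubset.prems(1) w by blast
    have inj: "inj_on (\<lambda>i. (R ^^ i) w) {..<p}"
    proof (rule linorder_inj_onI)
      fix i j assume ij: "i < j" "i \<in> {..<p}" "j \<in> {..<p}"
      show "(R ^^ i) w \<noteq> (R ^^ j) w"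
      proof
        assume "(R ^^ i) w = (R ^^ j) w"
        \<comment> \<open>Completing the i-th power to the p-th turns the collision into the period
          j - i, which lies strictly between 0 and p.\<close>
        then have "(R ^^ (p - i)) ((R ^^ i) w) = (R ^^ (p - i)) ((R ^^ j) w)" by simp
        then have "(R ^^ (p - i + i)) w = (R ^^ (p - i + j)) w" by (simp only: funpow_add o_apply)
        moreover have "p - i + i = p" "p - i + j = (j - i) + p" using ij by auto
        ultimately have "(R ^^ p) w = (R ^^ (j - i)) ((R ^^ p) w)"
          by (simp only: funpow_add o_apply)
        then have "(R ^^ (j - i)) w = w" using psubset.prems(2)[OF w] by simp
        then have "R w = w"
          using funpow_period_prime[OF p psubset.prems(2)[OF w], of "j - i"] ij by auto
        then show False using psubset.prems(3)[OF w] by blast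
      qed
    qed auto
    have hp: "h ((R ^^ i) w) = h w" for i
    proof (induction i)
      case (Suc i)
      have "(R ^^ i) w \<in> W" using funpow_invariant_set[of W R w] psubset.prems(1) w by blast
      then show ?case using psubset.prems(4) Suc by simp
    qed simp
    have "sum h ?O = (\<Sum>i<p. h ((R ^^ i) w))" by (simp add: sum.reindex[OF inj])
    also have "\<dots> = 0" using char by (simp add: hp)
    finally have O: "sum h ?O = 0" .
    have "sum h (W - ?O) = 0"
    proof (rule psubset.IH)
      have "w \<in> ?O" using p0 by (intro image_eqI[of _ _ 0]) auto
      then show "W - ?O \<subset> W" using w by blast
      show "R v \<in> W - ?O" if v: "v \<in> W - ?O" for v
      proof -
        have "R v \<notin> ?O"
        proof
          assume "R v \<in> ?O"
          then obtain i where i: "R v = (R ^^ i) w" by blast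
          \<comment> \<open>The power p - 1 inverts \<open>R\<close>, so a point mapped into the
            orbit lies in the orbit already.\<close>
          have "v = (R ^^ (p - 1 + 1)) v" using psubset.prems(2)[of v] v p0 by simp
          also have "\<dots> = (R ^^ (p - 1)) (R v)" by (simp add: funpow_swap1)
          also have "\<dots> = (R ^^ (p - 1 + i)) w" unfolding i by (simp only: funpow_add o_apply)
          also have "\<dots> = (R ^^ ((p - 1 + i) mod p)) w"
          proof -
            have per: "(R ^^ (p * y)) w = w" for y
            proof (induction y)
              case (Suc y)
              then show ?case using psubset.prems(2)[OF w] by (simp add: funpow_add)
            qed simp
            have "(R ^^ ((p - 1 + i) mod p + p * ((p - 1 + i) div p))) w = (R ^^ ((p - 1 + i) mod p)) w"
              unfolding funpow_add o_apply per ..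
            then show ?thesis by simp
          qed
          finally have "v \<in> ?O" using p0 by (metis image_eqI lessThan_iff mod_less_divisor)
          then show False using v by blast
        qed
        then show ?thesis using v psubset.prems(1) by blast
      qed
    qed (use psubset.prems in auto)
    then show ?thesis using sum.subset_diff[OF OW psubset.hyps, of h] O by simp
  qed simp
qed

section \<open>The module of words with a constant even prefix\<close>

context super_words
begin

text \<open>\<open>rotate_word k\<close> moves the first letter to position \<open>k\<close>; \<open>rotate_sign k\<close> is its accumulated sign.\<close>

fun rotate_word :: "nat \<Rightarrow> nat \<Rightarrow> nat" where
  "rotate_word 0 t = t"
| "rotate_word (Suc k) t = swp k (rotate_word k t)"

fun rotate_sign :: "nat \<Rightarrow> nat \<Rightarrow> int" where
  "rotate_sign 0 t = 1"
| "rotate_sign (Suc k) t = sgn_at k (rotate_word k t) * rotate_sign k t"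

lemma rotate_word_less: "t < tensor_dim m n d \<Longrightarrow> rotate_word k t < tensor_dim m n d"
  by (cases k) (auto simp: swp_less)

lemma letter_rotate_word:
  assumes "k < d" "l < d"
  shows "letter (rotate_word k t) l = letter t (if l < k then Suc l else if l = k then 0 else l)"
  using assms
proof (induction k arbitrary: l)
  case (Suc k)
  then have "letter (rotate_word (Suc k) t) l = letter (rotate_word k t) (transpose k (Suc k) l)"
    by (simp add: letter_swp)
  also have "\<dots> = letter t (if l < Suc k then Suc l else if l = Suc k then 0 else l)"
    using Suc by (auto simp: transpose_def)
  finally show ?case .
qed simp

lemma rotate_sign_square: "rotate_sign k t * rotate_sign k t = 1"
proof (induction k)
  case (Suc k)
  have "rotate_sign (Suc k) t * rotate_sign (Suc k) t
      = (sgn_at k (rotate_word k t) * sgn_at k (rotate_word k t)) * (rotate_sign k t * rotate_sign k t)"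
    by (simp add: ac_simps)
  then show ?case using Suc by (simp only: super_sign_square mult_1_left)
qed simp

lemma commutant_rotate:
  fixes A :: "'a::comm_ring_1 mat"
  assumes A: "A \<in> commutant" and k: "k < d" and x: "x < tensor_dim m n d" "y < tensor_dim m n d"
  shows "A $$ (rotate_word k x, rotate_word k y)
    = of_int (rotate_sign k x * rotate_sign k y) * A $$ (x, y)"
  using k
proof (induction k)
  case (Suc k)
  have "A $$ (swp k (rotate_word k x), swp k (rotate_word k y))
      = of_int (sgn_at k (rotate_word k x) * sgn_at k (rotate_word k y))
        * A $$ (rotate_word k x, rotate_word k y)"
    using A Suc.prems rotate_word_less x by (simp add: commutant_def)
  then show ?case using Suc by (simp add: ac_simps)
qed simp

text \<open>Words whose first \<open>p\<close> letters are one and the same even letter. Cutting matrices down to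
  these words is multiplicative in characteristic \<open>p\<close>, because the cyclic rotation of the
  first \<open>p\<close> letters groups all other intermediate words into orbits of length \<open>p\<close>, apart
  from words with \<open>p\<close> equal odd letters, where the entries vanish.\<close>

definition const_prefix :: "nat \<Rightarrow> nat \<Rightarrow> bool" where
  "const_prefix p t \<longleftrightarrow> (\<forall>l<p. letter t l = letter t 0)"

definition const_words :: "nat \<Rightarrow> nat set" where
  "const_words p = {t. t < tensor_dim m n d \<and> letter t 0 < m \<and> const_prefix p t}"

lemma const_prefixD: "const_prefix p t \<Longrightarrow> l < p \<Longrightarrow> letter t l = letter t 0"
  unfolding const_prefix_def by blast

lemma finite_const_words: "finite (const_words p)"
  by (rule finite_subset[of _ "{..<tensor_dim m n d}"]) (auto simp: const_words_def)

text \<open>\<open>rotate_word (p - 1)\<close> is a p-cycle on the places below p: the first letter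
  goes to place p - 1, the last one of the prefix.\<close>

lemma letter_rotate_funpow:
  assumes p: "0 < p" "p \<le> d" and l: "l < d"
  shows "letter ((rotate_word (p - 1) ^^ i) t) l = letter t (if l < p then (l + i) mod p else l)"
  using l
proof (induction i arbitrary: l)
  case (Suc i)
  have k: "p - 1 < d" using p by simp
  let ?l = "if l < p - 1 then Suc l else if l = p - 1 then 0 else l"
  have "letter ((rotate_word (p - 1) ^^ Suc i) t) l = letter ((rotate_word (p - 1) ^^ i) t) ?l"
    using letter_rotate_word[OF k Suc.prems] by simp
  also have "\<dots> = letter t (if ?l < p then (?l + i) mod p else ?l)"
    by (rule Suc.IH) (use Suc.prems p in auto)
  also have "\<dots> = letter t (if l < p then (l + Suc i) mod p else l)"
  proof -
    consider "Suc l < p" | "Suc l = p" | "p \<le> l" by linarith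
    then show ?thesis
    proof cases
      case 2
      then have "Suc (l + i) mod p = i mod p" by (metis add_Suc mod_add_self1)
      then show ?thesis using 2 by auto
    qed (use p(1) in auto)
  qed
  finally show ?case .
qed simp

lemma rotate_word_period:
  assumes p: "0 < p" "p \<le> d" and t: "t < tensor_dim m n d"
  shows "(rotate_word (p - 1) ^^ p) t = t"
proof (rule words_eqI)
  show "(rotate_word (p - 1) ^^ p) t < tensor_dim m n d"
    using funpow_invariant_set[of "{..<tensor_dim m n d}" "rotate_word (p - 1)" t p] rotate_word_less t
    by auto
qed (use letter_rotate_funpow[OF p, of _ p t] t in auto)

lemma rotate_word_fix_iff:
  assumes p: "0 < p" "p \<le> d" and t: "t < tensor_dim m n d"
  shows "rotate_word (p - 1) t = t \<longleftrightarrow> const_prefix p t"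
proof
  assume eq: "rotate_word (p - 1) t = t"
  have "letter t l = letter t 0" if "l < p" for l
    using that
  proof (induction l)
    case (Suc l)
    have "letter (rotate_word (p - 1) t) l = letter t (Suc l)"
      using Suc.prems p by (subst letter_rotate_word) auto
    then show ?case using Suc eq by simp
  qed simp
  then show "const_prefix p t" unfolding const_prefix_def by blast
next
  assume eq: "const_prefix p t"
  show "rotate_word (p - 1) t = t"
  proof (rule words_eqI)
    fix l assume l: "l < d"
    show "letter (rotate_word (p - 1) t) l = letter t l"
      using letter_rotate_word[of "p - 1" l t] l p const_prefixD[OF eq, of l] const_prefixD[OF eq, of "Suc l"]
      by auto
  qed (use t rotate_word_less in auto)
qed

text \<open>Each swap of the rotation moves the original first letter, which is even.\<close>

lemma rotate_sign_const:
  assumes "t \<in> const_words p" "k < p" "p \<le> d" shows "rotate_sign k t = 1"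
  using assms(2)
proof (induction k)
  case (Suc k)
  then have "letter (rotate_word k t) k = letter t 0"
    using assms letter_rotate_word[of k k t] by simp
  with assms(1) have "letter (rotate_word k t) k < m" by (simp add: const_words_def)
  then have "sgn_at k (rotate_word k t) = 1"
    by (simp add: super_sign_def)
  then show ?case using Suc by simp
qed simp

text \<open>The swap of the first two places fixes both words, with sign 1 on the even prefix and -1
  on the odd one, so the entry equals its own negative.\<close>

lemma commutant_const_odd_eq_0:
  fixes A :: "'a::comm_ring_1 mat"
  assumes two: "\<And>a::'a. a + a = 0 \<Longrightarrow> a = 0" and A: "A \<in> commutant" and p: "2 \<le> p" "p \<le> d"
    and t: "t \<in> const_words p" and u: "u < tensor_dim m n d" "m \<le> letter u 0"
      "const_prefix p u"
  shows "A $$ (t, u) = 0"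
proof -
  have j: "Suc 0 < d" using p by simp
  have eq: "swp 0 v = v" if "v < tensor_dim m n d" "const_prefix p v" for v
  proof (rule words_eqI)
    fix l assume "l < d"
    then show "letter (swp 0 v) l = letter v l"
      using const_prefixD[OF that(2), of "Suc 0"] p j by (auto simp: letter_swp transpose_def)
  qed (use that swp_less in auto)
  have t': "t < tensor_dim m n d" "swp 0 t = t" "sgn_at 0 t = 1"
    using t eq[of t] by (auto simp: const_words_def super_sign_def)
  have u': "swp 0 u = u" "sgn_at 0 u = - 1"
    using u eq[of u] const_prefixD[OF u(3), of "Suc 0"] p by (auto simp: super_sign_def)
  have "A $$ (swp 0 t, swp 0 u) = of_int (sgn_at 0 t * sgn_at 0 u) * A $$ (t, u)"
    using A j t'(1) u(1) by (simp add: commutant_def)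
  then have "A $$ (t, u) = - A $$ (t, u)" using t' u' by simp
  then have "A $$ (t, u) + A $$ (t, u) = 0" by (simp add: eq_neg_iff_add_eq_0)
  then show ?thesis by (rule two)
qed

lemma commutant_mult_const_words:
  fixes A B :: "'a::comm_ring_1 mat"
  assumes two: "\<And>a::'a. a + a = 0 \<Longrightarrow> a = 0" and p: "prime p" "p \<le> d" and char: "of_nat p = (0::'a)"
    and A: "A \<in> commutant" and B: "B \<in> commutant" and t: "t \<in> const_words p" "t' \<in> const_words p"
  shows "(A * B) $$ (t, t') = (\<Sum>u\<in>const_words p. A $$ (t, u) * B $$ (u, t'))"
proof -
  let ?N = "tensor_dim m n d" and ?R = "rotate_word (p - 1)"
  define h where "h u = A $$ (t, u) * B $$ (u, t')" for u
  have p2: "2 \<le> p" using p prime_ge_2_nat by blast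
  have p0: "0 < p" "p - 1 < d" "p - 1 < p" using p2 p by auto
  have tN: "t < ?N" "t' < ?N" using t by (auto simp: const_words_def)
  define U where "U = {u. u < ?N \<and> ?R u = u}"
  define W where "W = {u. u < ?N \<and> ?R u \<noteq> u}"
  have Rt: "?R t = t" "?R t' = t'"
    using rotate_word_fix_iff[OF p0(1) p(2)] t tN by (auto simp: const_words_def)
  \<comment> \<open>\<open>t\<close> and \<open>t'\<close> are fixed with sign 1, and the sign of
    \<open>u\<close> occurs once in each factor.\<close>
  have hR: "h (?R u) = h u" if u: "u < ?N" for u
  proof -
    have "A $$ (t, ?R u) = of_int (rotate_sign (p - 1) u) * A $$ (t, u)"
      using commutant_rotate[OF A p0(2) tN(1) u] Rt rotate_sign_const[OF t(1) p0(3) p(2)] by simp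
    moreover have "B $$ (?R u, t') = of_int (rotate_sign (p - 1) u) * B $$ (u, t')"
      using commutant_rotate[OF B p0(2) u tN(2)] Rt rotate_sign_const[OF t(2) p0(3) p(2)] by simp
    ultimately have "h (?R u)
        = of_int (rotate_sign (p - 1) u * rotate_sign (p - 1) u) * (A $$ (t, u) * B $$ (u, t'))"
      by (simp add: h_def ac_simps)
    then show ?thesis by (simp only: rotate_sign_square of_int_1 mult_1_left h_def)
  qed
  have Rinj: "u = v" if "?R u = ?R v" "u < ?N" "v < ?N" for u v
  proof -
    have "(?R ^^ p) w = (?R ^^ (p - 1)) (?R w)" for w
      using funpow_Suc_right[of "p - 1" ?R] p0(1) by simp
    then have "(?R ^^ p) u = (?R ^^ p) v" using that(1) by simp
    then show ?thesis using rotate_word_period[OF p0(1) p(2)] that(2,3) by simp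
  qed
  have "sum h W = 0"
  proof (rule sum_prime_orbits_eq_0[OF p(1) char, where R = ?R])
    show "finite W" by (simp add: W_def)
    show "?R v \<in> W" if "v \<in> W" for v
      using that rotate_word_less[of v "p - 1"] Rinj[of "?R v" v] by (auto simp: W_def)
  qed (use rotate_word_period[OF p0(1) p(2)] hR in \<open>auto simp: W_def\<close>)
  moreover have "(A * B) $$ (t, t') = sum h {..<?N}"
    unfolding h_def by (rule index_mult_mat_sum[OF commutant_carrier[OF A] commutant_carrier[OF B] tN])
  moreover have "{..<?N} = U \<union> W" "U \<inter> W = {}" "finite U" "finite W"
    by (auto simp: U_def W_def)
  \<comment> \<open>Fixed words outside \<open>const_words p\<close> have a constant odd
    prefix.\<close>
  moreover have "sum h U = sum h (const_words p)"
  proof (rule sum.mono_neutral_right[OF \<open>finite U\<close>])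
    show "const_words p \<subseteq> U"
      using rotate_word_fix_iff[OF p0(1) p(2)] by (auto simp: const_words_def U_def)
    show "\<forall>u\<in>U - const_words p. h u = 0"
    proof
      fix u assume u: "u \<in> U - const_words p"
      then have "u < ?N" "const_prefix p u"
        using rotate_word_fix_iff[OF p0(1) p(2), of u] by (auto simp: U_def)
      moreover from this u have "m \<le> letter u 0" by (auto simp: const_words_def)
      ultimately have "A $$ (t, u) = 0"
        using commutant_const_odd_eq_0[OF two A p2 p(2) t(1)] by blast
      then show "h u = 0" by (simp add: h_def)
    qed
  qed
  ultimately show ?thesis by (simp add: sum.union_disjoint h_def)
qed

definition const_module :: "nat \<Rightarrow> (nat \<Rightarrow> nat) \<Rightarrow> 'k::field fdmod" where
  "const_module p e = (card (const_words p),
     \<lambda>a. mat (card (const_words p)) (card (const_words p)) (\<lambda>(i, j). a $$ (e i, e j)))"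

lemma is_module_const_module:
  assumes two: "\<And>a::'k::field. a + a = 0 \<Longrightarrow> a = 0" and p: "prime p" "p \<le> d" and char: "of_nat p = (0::'k)"
    and e: "bij_betw e {..<card (const_words p)} (const_words p)"
  shows "is_module (tensor_dim m n d) (commutant :: 'k mat set) (const_module p e)"
proof -
  let ?r = "card (const_words p)" and ?N = "tensor_dim m n d"
  let ?\<rho> = "\<lambda>a :: 'k mat. mat ?r ?r (\<lambda>(i, j). a $$ (e i, e j))"
  have ec: "e i \<in> const_words p" "e i < ?N" if "i < ?r" for i
    using e that by (auto simp: bij_betw_def const_words_def)
  have inj: "e i = e j \<longleftrightarrow> i = j" if "i < ?r" "j < ?r" for i j
    using e that by (auto simp: bij_betw_def inj_on_def)
  have "?\<rho> (1\<^sub>m ?N) = 1\<^sub>m ?r"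
    by (intro eq_matI) (auto simp: ec inj)
  moreover have "?\<rho> (a * b) = ?\<rho> a * ?\<rho> b" if ab: "a \<in> commutant" "b \<in> commutant" for a b
  proof (rule eq_matI)
    fix i j assume "i < dim_row (?\<rho> a * ?\<rho> b)" "j < dim_col (?\<rho> a * ?\<rho> b)"
    then have ij: "i < ?r" "j < ?r" by auto
    have "(?\<rho> a * ?\<rho> b) $$ (i, j) = (\<Sum>l<?r. ?\<rho> a $$ (i, l) * ?\<rho> b $$ (l, j))"
      by (rule index_mult_mat_sum) (use ij in auto)
    also have "\<dots> = (\<Sum>l<?r. a $$ (e i, e l) * b $$ (e l, e j))"
      using ij by simp
    also have "\<dots> = (\<Sum>u\<in>const_words p. a $$ (e i, u) * b $$ (u, e j))"
      by (rule sum.reindex_bij_betw[OF e])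
    also have "\<dots> = ?\<rho> (a * b) $$ (i, j)"
      using ij commutant_mult_const_words[OF two p char ab ec(1)[OF ij(1)] ec(1)[OF ij(2)]]
      by (simp del: index_mult_mat(1))
    finally show "?\<rho> (a * b) $$ (i, j) = (?\<rho> a * ?\<rho> b) $$ (i, j)" by (rule sym)
  qed auto
  moreover have "?\<rho> (a + b) = ?\<rho> a + ?\<rho> b" if "a \<in> commutant" "b \<in> commutant" for a b
    using that[THEN commutant_carrier] by (intro eq_matI) (auto simp: ec)
  moreover have "?\<rho> (c \<cdot>\<^sub>m a) = c \<cdot>\<^sub>m ?\<rho> a" if "a \<in> commutant" for a c
    using that[THEN commutant_carrier] by (intro eq_matI) (auto simp: ec)
  ultimately show ?thesis by (simp add: is_module_def const_module_def)
qed

text \<open>The only word of \<open>const_words p\<close> counted by \<open>signed_weight p\<close> is \<open>0\<^sup>p (m+1)\<^bsup>d-p\<^esup>\<close>.\<close>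

lemma sum_signed_weight_const_words:
  assumes p: "0 < p" "p \<le> d" shows "(\<Sum>t\<in>const_words p. signed_weight p t) = 1"
proof -
  define w where "w = word_index q d (\<lambda>l. if l < p then 0 else Suc m)"
  have lw: "letter w l = (if l < p then 0 else Suc m)" if "l < d" for l
    unfolding w_def by (rule digit_word_index) (use that n_two m_pos in auto)
  have wN: "w < tensor_dim m n d"
    unfolding w_def tensor_dim_def by (rule word_index_less) (use n_two m_pos in auto)
  have w: "w \<in> const_words p" using wN lw p m_pos by (auto simp: const_words_def const_prefix_def)
  have low: "(\<Sum>l<d. if l < p then 1 else 0) = int p"
  proof -
    have "{..<d} \<inter> {l. l < p} = {..<p}" using p by auto
    then show ?thesis by (simp add: sum.If_cases)
  qed
  have "ab_count w = (\<Sum>l<d. if l < p then 1 else 0)"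
    unfolding ab_count_def by (intro sum.cong refl) (simp add: lw)
  then have "ab_count w = int p" using low by simp
  then have sw: "signed_weight p w = 1"
    using lw m_pos by (auto simp: signed_weight_def intro!: prod.neutral)
  have "signed_weight p t = 0" if t: "t \<in> const_words p - {w}" for t
  proof (rule ccontr)
    assume "signed_weight p t \<noteq> 0"
    then have cnt: "ab_count t = int p" and supp: "\<And>l. l < d \<Longrightarrow> ab_letter (letter t l) \<or> letter t l = Suc m"
      by (auto simp: signed_weight_def split: if_splits)
    have t': "t < tensor_dim m n d" "letter t 0 < m" "\<And>l. l < p \<Longrightarrow> letter t l = letter t 0"
      using t const_prefixD by (auto simp: const_words_def)
    \<comment> \<open>Among the letters 0, \<open>m\<close> and \<open>Suc m\<close> that the weight
      admits, only 0 is even.\<close>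
    have "letter t 0 = 0" using supp[of 0] t'(2) p by auto
    then have zero: "letter t l = 0" if "l < p" for l using t'(3)[OF that] by simp
    \<comment> \<open>The prefix already supplies p letters of gl(1|1), the full count. All
      differences are nonnegative with sum 0, so every later letter is \<open>Suc m\<close>.\<close>
    have eq: "(\<Sum>l<d. (if ab_letter (letter t l) then 1 else 0) - (if l < p then 1 else 0)) = (0::int)"
      using cnt low by (simp add: ab_count_def sum_subtractf)
    have "(if ab_letter (letter t l) then 1 else 0) - (if l < p then 1 else 0) = (0::int)" if "l < d" for l
    proof -
      have "\<forall>l\<in>{..<d}. (if ab_letter (letter t l) then 1 else 0) - (if l < p then 1 else 0) = (0::int)"
        by (rule sum_nonneg_eq_0_iff[THEN iffD1, OF _ _ eq]) (auto simp: zero)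
      then show ?thesis using that by blast
    qed
    then have "letter t l = letter w l" if "l < d" for l
      using that supp[OF that] lw[OF that] zero[of l] by (fastforce split: if_splits)
    then have "t = w" using words_eqI t'(1) wN by blast
    then show False using t by blast
  qed
  then show ?thesis
    using sum.remove[OF finite_const_words w, of "signed_weight p"] sw by simp
qed

lemma mat_trace_const_module_weight:
  assumes p: "0 < p" "p \<le> d" and e: "bij_betw e {..<card (const_words p)} (const_words p)"
  shows "mat_trace (snd (const_module p e) (map_mat of_int (weight_mat p))) = (1 :: 'k::field)"
proof -
  have eN: "e i < tensor_dim m n d" if "i < card (const_words p)" for i
    using e that by (auto simp: bij_betw_def const_words_def)
  have "mat_trace (snd (const_module p e) (map_mat of_int (weight_mat p)))
      = (\<Sum>i<card (const_words p). of_int (signed_weight p (e i)) :: 'k)"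
    by (simp add: mat_trace_def const_module_def weight_mat_def mat_diag_def eN)
  also have "\<dots> = (\<Sum>t\<in>const_words p. of_int (signed_weight p t))"
    by (rule sum.reindex_bij_betw[OF e])
  also have "\<dots> = of_int (\<Sum>t\<in>const_words p. signed_weight p t)" by simp
  also have "\<dots> = 1" using sum_signed_weight_const_words[OF p] by simp
  finally show ?thesis .
qed

lemma infinite_global_dim_schur_superalgebra:
  assumes p: "prime p" "p \<noteq> 2" "p \<le> d" and char: "CHAR('k::field) = p"
  shows "infinite_global_dim (tensor_dim m n d) (schur_superalgebra m n d :: 'k mat set)"
proof -
  have two: "a = 0" if "a + a = 0" for a :: 'k
  proof -
    have "of_nat 2 \<noteq> (0 :: 'k)"
      using p char primes_dvd_imp_eq[OF p(1) two_is_prime_nat] by (simp only: of_nat_eq_0_iff_char_dvd) auto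
    moreover have "of_nat 2 * a = 0" using that by (simp only: of_nat_numeral mult_2)
    ultimately show ?thesis by (metis mult_eq_0_iff)
  qed
  have char0: "of_nat p = (0 :: 'k)" using char by (simp add: of_nat_eq_0_iff_char_dvd)
  have p0: "0 < p" using p prime_gt_0_nat by blast
  obtain e where e: "bij_betw e {..<card (const_words p)} (const_words p)"
    using ex_bij_betw_nat_finite[OF finite_const_words] by (auto simp: atLeast0LessThan)
  have M: "is_module (tensor_dim m n d) (commutant :: 'k mat set) (const_module p e)"
    by (rule is_module_const_module[OF two p(1,3) char0 e])
  have Z: "map_mat of_int (weight_mat p) \<in> (commutant :: 'k mat set)"
    using weight_mat_commutant[of p] act_closed by (auto simp: commutant_def)
  \<comment> \<open>One module, independent of \<open>l\<close>, excludes all lengths at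
    once.\<close>
  have "\<not> proj_dim_le (tensor_dim m n d) (commutant :: 'k mat set) (const_module p e) l" for l
  proof
    assume pd: "proj_dim_le (tensor_dim m n d) (commutant :: 'k mat set) (const_module p e) l"
    have "mat_trace (snd (const_module p e) (map_mat of_int (weight_mat p))) = (0 :: 'k)"
      by (rule mat_trace_zero_of_proj_dim_le[OF pd M Z])
        (rule mat_trace_weight_projective_eq_0[OF two], use p0 in auto)
    then show False using mat_trace_const_module_weight[OF p0 p(3) e, where 'k = 'k] by simp
  qed
  then show ?thesis
    using M unfolding infinite_global_dim_def schur_superalgebra_eq_commutant by blast
qed

end

theorem theorem5p1p1:
  fixes p m n d :: nat
  assumes "CHAR('k::alg_closed_field) = p"
    and "p \<ge> 5" and "d \<ge> p"
    and "m \<ge> d" and "n \<ge> d"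
  shows "infinite_global_dim (tensor_dim m n d)
           (schur_superalgebra m n d :: 'k mat set)"
proof -
  interpret super_words m n d by unfold_locales (use assms in auto)
  have "prime p" using prime_CHAR_semidom[where 'a = 'k] assms by auto
  then show ?thesis
    by (intro infinite_global_dim_schur_superalgebra[of p]) (use assms in auto)
qed

end
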